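(* Suppose that $\Gamma$ is a properly discontinuous subgroup of $G$ contained in $G^{\mathrm{res}}$ such that $\Gamma_\infty=\{\mathrm{id}\}$ and $\infty\in\Omega(\Gamma)$. Then $\Gamma$ is of type (O) and $\Gamma\smallsetminus\Gamma_\infty$ is of type (F). Moreover, $$\mathcal F:=\bigcap_{g\in\Gamma\smallsetminus\Gamma_\infty}\mathrm{Ext}\, I(g)$$ is a fundamental domain for $\Gamma$ in $H$.
   Context: **$J^2C$-module structures.** A $J^2C$-module structure is a triple $(C,V,J)$ of two finite-dimensional real inner product spaces $C,V$ and an $\mathbb R$-bilinear map $J\colon C\times V\to V$, written $\zeta v=J(\zeta,v)$, such that (1) there is $e\in C\smallsetminus\{0\}$ with $J(e,v)=v$ for all $v$; (2) $|J(\zeta,v)|=|\zeta||v|$; (3) $C(Cv)=Cv$ for all $v\in V$, where $Cv=\{\zeta v\mid\zeta\in C\}$ and $C(Cv)=\{\zeta(\eta v)\mid\zeta,\eta\in C\}$. If $V\ne\{0\}$, $e$ is unique and $|e|=1$. Identify $\mathbb Re$ with $\mathbb R$, put $C'=e^\perp$, and for $\zeta=a+z$ ($a\in\mathbb R$, $z\in C'$) put $\mathrm{Re}\,\zeta=a$, $\mathrm{Im}\,\zeta=z$, $\overline\zeta=a-z$, $\zeta^{-1}=|\zeta|^{-2}\overline\zeta$ (if $\zeta\neq 0$). Throughout, $(C,V,J)$ is associative: $V\neq\{0\}$ and the multiplication on $C$ given by $\zeta(\eta v)=(\zeta\cdot_v\eta)v$ is associative for some (equivalently, every) $v\in V\smallsetminus\{0\}$;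 it is then independent of $v$. Define $\beta_2\colon V\times V\to C$ by $\langle\beta_2(v,u),\zeta\rangle=\langle\zeta u,v\rangle$ for all $\zeta\in C$, and $[\cdot,\cdot]\colon V\times V\to C'$ by $\langle z,[x,y]\rangle=\langle J(z,x),y\rangle$ for all $z\in C'$. **The models $D$ and $H$.** Let $S=\mathbb R^+\times C'\times V$ be the Lie group with product $(t_1,Z_1,X_1)(t_2,Z_2,X_2)=(t_1t_2,Z_1+t_1Z_2+\tfrac12t_1^{1/2}[X_1,X_2],X_1+t_1^{1/2}X_2)$ and the left-invariant Riemannian metric equal at $(1,0,0)$ to the standard inner product of $\mathbb R\oplus C'\oplus V$. Let $D=\{(\zeta,v)\in C\oplus V\mid\mathrm{Re}\,\zeta>\tfrac14|v|^2\}$ with the metric making $S\to D$, $(t,Z,X)\mapsto(t+\tfrac14|X|^2+Z,X)$ an isometry; let $G$ be its full isometry group, whose action extends continuously to $\overline D^g=\{\mathrm{Re}\,\zeta\ge\tfrac14|v|^2\}\cup\{\infty\}$ (closure in the one-point compactification of $C\oplus V$). Let $H=\{(\zeta,v)\in C\oplus V\mid\mathrm{Re}\,\zeta>\tfrac12|v|^2\}$, let $\overline H^g=\{\mathrm{Re}\,\zeta\ge\tfrac12|v|^2\}\cup\{\infty\}$ be its closure in the one-point compactification, and $\partial_gH=\overline H^g\smallsetminus H$. The map $\beta\colon\overline H^g\to\overline D^g$, $\beta(\zeta,v)=(\zeta,\sqrt2v)$, $\beta(\infty)=\infty$, is a bijection; $H$ carries the Riemannian metric making $\beta|_H$ an isometry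 onto $D$, and $G$ acts on $\overline H^g$ by $z\mapsto\beta^{-1}(g\beta(z))$, so $G$ is the full isometry group of $H$. $G_\infty$ is the stabilizer of $\infty$, and $\Gamma_\infty=\Gamma\cap G_\infty$. **Subgroups (acting on $\overline D^g$).** $a_t(\zeta,v)=(t\zeta,t^{1/2}v)$, $A=\{a_t\mid t>0\}$; $n_{(Z,X)}(\zeta,v)=(\tfrac14|X|^2+Z+\zeta+\tfrac12\beta_2(v,X),X+v)$, $N=\{n_{(Z,X)}\mid Z\in C',X\in V\}$; $M$ is the group of pairs $(\varphi,\psi)$ of orthogonal maps of $C$, resp. $V$, with $\varphi(e)=e$, $\psi(\zeta v)=\varphi(\zeta)\psi(v)$, acting by $(\zeta,v)\mapsto(\varphi(\zeta),\psi(v))$; all fix $\infty$. $\sigma(\zeta,v)=(\zeta^{-1},-\zeta^{-1}v)$, $\sigma0=\infty$, $\sigma\infty=0$. $G_\infty=MAN$ and each $g\in G\smallsetminus G_\infty$ is uniquely $g=n_1\sigma ma_tn_2$ with $n_1,n_2\in N,m\in M,a_t\in A$. Put $M^{\mathrm{res}}=\{(\varphi,\psi)\in M\mid\varphi=\mathrm{id}\}$ and $G^{\mathrm{res}}=N\sigma M^{\mathrm{res}}AN\cup M^{\mathrm{res}}AN$. **Isometric spheres in $H$.** The height on $H$ is $\mathrm{ht}^H(\zeta,v)=\mathrm{Re}\,\zeta-\tfrac12|v|^2$ and the Cygan metric on $\overline H^g\smallsetminus\{\infty\}$ is, for $z_j=(\zeta_j,v_j)$, $\varrho^H(z_1,z_2)=\big|\tfrac12|v_1|^2+\tfrac12|v_2|^2+|\mathrm{ht}^H(z_1)-\mathrm{ht}^H(z_2)|+\mathrm{Im}\,\zeta_1-\mathrm{Im}\,\zeta_2-\beta_2(v_1,v_2)\big|^{1/2}$.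 For $g=n_1\sigma ma_tn_2\in G\smallsetminus G_\infty$ put $R(g)=t^{-1/4}$, and let $I(g),\mathrm{Ext}\,I(g),\mathrm{Int}\,I(g)$ be the sets of $z\in H$ with $\varrho^H(z,g^{-1}\infty)=R(g)$, $>R(g)$, $<R(g)$. **Types, fundamental domains.** $\Gamma$ is of type (O) if $\bigcap_{g\in\Gamma\smallsetminus\Gamma_\infty}\mathrm{Ext}\,I(g)=H\smallsetminus\overline{\bigcup_{g\in\Gamma\smallsetminus\Gamma_\infty}\mathrm{Int}\,I(g)}$. A subset $T\subseteq G$ is of type (F) if for each $z\in H$ the maximum of $\{\mathrm{ht}^H(gz)\mid g\in\langle T\rangle\}$ exists ($\langle T\rangle$ the subgroup generated by $T$). A fundamental domain for $\Gamma$ in $H$ is a connected open set $Y\subseteq H$ whose translates by any two distinct elements of $\Gamma$ are disjoint and with $H=\bigcup_{g\in\Gamma}g\overline Y$. Closures are in $H$; an intersection over the empty index set is $H$. **Discontinuity.** A subgroup $\Gamma$ of $G$ is properly discontinuous if for every compact $K\subseteq H$ the set $K\cap gK$ is nonempty for only finitely many $g\in\Gamma$. Its limit set $L(\Gamma)\subseteq\partial_gH$ is the set of accumulation points in $\overline H^g$ of an orbit $\Gamma z$, $z\in H$ (independent of $z$), and $\Omega(\Gamma)=\partial_gH\smallsetminus L(\Gamma)$. *)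

theory Defs
  imports "HOL-Analysis.Analysis" "HOL-Algebra.Generated_Groups"
begin

section \<open>Smooth maps\<close>

text \<open>\<open>Ck_on k f U\<close> is meant for open \<open>U\<close>: all directional derivatives of order at most
  \<open>k\<close> exist as Frechet derivatives and are continuous.\<close>

primrec Ck_on ::
  "nat \<Rightarrow> ('a::real_normed_vector \<Rightarrow> 'b::real_normed_vector) \<Rightarrow> 'a set \<Rightarrow> bool" where
  "Ck_on 0 f U \<longleftrightarrow> continuous_on U f"
| "Ck_on (Suc k) f U \<longleftrightarrow> (\<forall>x\<in>U. f differentiable (at x)) \<and>
     (\<forall>w. Ck_on k (\<lambda>x. frechet_derivative f (at x) w) U)"

definition smooth_on :: "('a::real_normed_vector \<Rightarrow> 'b::real_normed_vector) \<Rightarrow> 'a set \<Rightarrow> bool" where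
  "smooth_on f U \<longleftrightarrow> (\<forall>k. Ck_on k f U)"


section \<open>Module structures\<close>

text \<open>The spaces \<open>C\<close> and \<open>V\<close> are types of class \<open>euclidean_space\<close>, i.e. nonzero
  finite-dimensional real inner product spaces; \<open>C\<close> contains \<open>e \<noteq> 0\<close>, and \<open>V \<noteq> {0}\<close> is part
  of associativity.\<close>

definition J2C_module :: "('c::euclidean_space \<Rightarrow> 'v::euclidean_space \<Rightarrow> 'v) \<Rightarrow> bool" where
  "J2C_module J \<longleftrightarrow>
     bilinear J \<and>
     (\<exists>e. e \<noteq> 0 \<and> (\<forall>v. J e v = v)) \<and>
     (\<forall>\<zeta> v. norm (J \<zeta> v) = norm \<zeta> * norm v) \<and>
     (\<forall>v. {J \<zeta> (J \<eta> v) |\<zeta> \<eta>. True} = {J \<zeta> v |\<zeta>. True})"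

context
  fixes J :: "'c::euclidean_space \<Rightarrow> 'v::euclidean_space \<Rightarrow> 'v"
begin

definition mult_at :: "'v \<Rightarrow> 'c \<Rightarrow> 'c \<Rightarrow> 'c" where
  "mult_at v \<zeta> \<eta> = (THE \<kappa>. J \<zeta> (J \<eta> v) = J \<kappa> v)"

definition J2C_associative :: bool where
  "J2C_associative \<longleftrightarrow> (\<exists>v. v \<noteq> 0 \<and>
     (\<forall>\<zeta> \<eta> \<kappa>. mult_at v (mult_at v \<zeta> \<eta>) \<kappa> = mult_at v \<zeta> (mult_at v \<eta> \<kappa>)))"

definition unitC :: 'c where
  "unitC = (THE e. e \<noteq> 0 \<and> (\<forall>v. J e v = v))"

definition Cprime :: "'c set" where
  "Cprime = {z. orthogonal unitC z}"

text \<open>\<open>reC\<close> is the coordinate along the unit vector \<open>e\<close>. Real numbers \<open>a\<close> are identified with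
  \<open>a *\<^sub>R unitC\<close>.\<close>

definition reC :: "'c \<Rightarrow> real" where
  "reC \<zeta> = \<zeta> \<bullet> unitC"

definition imC :: "'c \<Rightarrow> 'c" where
  "imC \<zeta> = \<zeta> - reC \<zeta> *\<^sub>R unitC"

definition conjC :: "'c \<Rightarrow> 'c" where
  "conjC \<zeta> = reC \<zeta> *\<^sub>R unitC - imC \<zeta>"

definition invC :: "'c \<Rightarrow> 'c" where
  "invC \<zeta> = (1 / (norm \<zeta>)\<^sup>2) *\<^sub>R conjC \<zeta>"

definition beta2 :: "'v \<Rightarrow> 'v \<Rightarrow> 'c" where
  "beta2 v u = (THE w. \<forall>\<zeta>. w \<bullet> \<zeta> = J \<zeta> u \<bullet> v)"

definition bracket :: "'v \<Rightarrow> 'v \<Rightarrow> 'c" where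
  "bracket x y = (THE w. w \<in> Cprime \<and> (\<forall>z\<in>Cprime. z \<bullet> w = J z x \<bullet> y))"


section \<open>The models\<close>

subsection \<open>The Lie group and the Riemannian metric on \<open>D\<close>\<close>

definition Sgrp :: "(real \<times> 'c \<times> 'v) monoid" where
  "Sgrp = \<lparr> carrier = {(t, Z, X). t > 0 \<and> Z \<in> Cprime},
     mult = (\<lambda>(t1, Z1, X1) (t2, Z2, X2).
       (t1 * t2, Z1 + t1 *\<^sub>R Z2 + (1/2 * sqrt t1) *\<^sub>R bracket X1 X2, X1 + sqrt t1 *\<^sub>R X2)),
     one = (1, 0, 0) \<rparr>"

text \<open>Riemannian metric at \<open>p\<close> for tangent vectors in \<open>\<real> \<oplus> C' \<oplus> V\<close>. The formula for the left
  translation makes sense for \<open>Z \<in> C\<close>; its differential is taken in this ambient space.\<close>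

definition metricS :: "real \<times> 'c \<times> 'v \<Rightarrow> real \<times> 'c \<times> 'v \<Rightarrow> real \<times> 'c \<times> 'v \<Rightarrow> real" where
  "metricS p \<xi> \<eta> =
     (let dL = frechet_derivative (mult Sgrp (m_inv Sgrp p)) (at p) in dL \<xi> \<bullet> dL \<eta>)"

definition Ddom :: "('c \<times> 'v) set" where
  "Ddom = {(\<zeta>, v). reC \<zeta> > 1/4 * (norm v)\<^sup>2}"

text \<open>The inverse of \<open>S \<rightarrow> D, (t, Z, X) \<mapsto> (t + 1/4 |X|\<^sup>2 + Z, X)\<close>.\<close>

definition D_to_S :: "'c \<times> 'v \<Rightarrow> real \<times> 'c \<times> 'v" where
  "D_to_S = (\<lambda>(\<zeta>, v). (reC \<zeta> - 1/4 * (norm v)\<^sup>2, imC \<zeta>, v))"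

definition metricD :: "'c \<times> 'v \<Rightarrow> 'c \<times> 'v \<Rightarrow> 'c \<times> 'v \<Rightarrow> real" where
  "metricD p \<xi> \<eta> =
     (let d = frechet_derivative D_to_S (at p) in metricS (D_to_S p) (d \<xi>) (d \<eta>))"

definition isometry_D :: "('c \<times> 'v \<Rightarrow> 'c \<times> 'v) \<Rightarrow> bool" where
  "isometry_D f \<longleftrightarrow>
     bij_betw f Ddom Ddom \<and> smooth_on f Ddom \<and> smooth_on (inv_into Ddom f) Ddom \<and>
     (\<forall>p\<in>Ddom. \<forall>\<xi> \<eta>.
        metricD (f p) (frechet_derivative f (at p) \<xi>) (frechet_derivative f (at p) \<eta>)
          = metricD p \<xi> \<eta>)"


subsection \<open>The group \<open>G\<close> acting on the closure of \<open>D\<close>\<close>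

text \<open>In the one-point compactification \<open>None\<close> is the point \<open>\<infinity>\<close>.\<close>

definition Dbar :: "('c \<times> 'v) option set" where
  "Dbar = Some ` {(\<zeta>, v). reC \<zeta> \<ge> 1/4 * (norm v)\<^sup>2} \<union> {None}"

definition Dbar_top :: "('c \<times> 'v) option topology" where
  "Dbar_top = subtopology (Alexandroff_compactification euclidean) Dbar"

text \<open>An isometry of \<open>D\<close> is represented by its (unique) continuous extension to \<open>Dbar\<close>, made
  total by the identity outside \<open>Dbar\<close>.\<close>

definition Ggrp :: "(('c \<times> 'v) option \<Rightarrow> ('c \<times> 'v) option) monoid" where
  "Ggrp = \<lparr> carrier = {g. g permutes Dbar \<and> homeomorphic_map Dbar_top Dbar_top g \<and>
                  (\<exists>f. isometry_D f \<and> (\<forall>p\<in>Ddom. g (Some p) = Some (f p)))},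
     mult = (\<circ>),
     one = id \<rparr>"

definition ext_Dbar :: "('c \<times> 'v \<Rightarrow> 'c \<times> 'v) \<Rightarrow> ('c \<times> 'v) option \<Rightarrow> ('c \<times> 'v) option" where
  "ext_Dbar f p = (if p \<in> Dbar then map_option f p else p)"

definition aD :: "real \<Rightarrow> ('c \<times> 'v) option \<Rightarrow> ('c \<times> 'v) option" where
  "aD t = ext_Dbar (\<lambda>(\<zeta>, v). (t *\<^sub>R \<zeta>, sqrt t *\<^sub>R v))"

definition nD :: "'c \<Rightarrow> 'v \<Rightarrow> ('c \<times> 'v) option \<Rightarrow> ('c \<times> 'v) option" where
  "nD Z X = ext_Dbar
     (\<lambda>(\<zeta>, v). ((1/4 * (norm X)\<^sup>2) *\<^sub>R unitC + Z + \<zeta> + (1/2) *\<^sub>R beta2 v X, X + v))"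

definition mD :: "('c \<Rightarrow> 'c) \<Rightarrow> ('v \<Rightarrow> 'v) \<Rightarrow> ('c \<times> 'v) option \<Rightarrow> ('c \<times> 'v) option" where
  "mD \<phi> \<psi> = ext_Dbar (\<lambda>(\<zeta>, v). (\<phi> \<zeta>, \<psi> v))"

definition sigmaD :: "('c \<times> 'v) option \<Rightarrow> ('c \<times> 'v) option" where
  "sigmaD p = (if p \<notin> Dbar then p else
     (case p of
        None \<Rightarrow> Some (0, 0)
      | Some (\<zeta>, v) \<Rightarrow> if (\<zeta>, v) = (0, 0) then None else Some (invC \<zeta>, - J (invC \<zeta>) v)))"

definition Agrp :: "(('c \<times> 'v) option \<Rightarrow> ('c \<times> 'v) option) set" where
  "Agrp = {aD t |t. t > 0}"

definition Ngrp :: "(('c \<times> 'v) option \<Rightarrow> ('c \<times> 'v) option) set" where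
  "Ngrp = {nD Z X |Z X. Z \<in> Cprime}"

definition Mpairs :: "(('c \<Rightarrow> 'c) \<times> ('v \<Rightarrow> 'v)) set" where
  "Mpairs = {(\<phi>, \<psi>). orthogonal_transformation \<phi> \<and> orthogonal_transformation \<psi> \<and>
     \<phi> unitC = unitC \<and> (\<forall>\<zeta> v. \<psi> (J \<zeta> v) = J (\<phi> \<zeta>) (\<psi> v))}"

definition Mgrp :: "(('c \<times> 'v) option \<Rightarrow> ('c \<times> 'v) option) set" where
  "Mgrp = {mD \<phi> \<psi> |\<phi> \<psi>. (\<phi>, \<psi>) \<in> Mpairs}"

definition Mres :: "(('c \<times> 'v) option \<Rightarrow> ('c \<times> 'v) option) set" where
  "Mres = {mD \<phi> \<psi> |\<phi> \<psi>. (\<phi>, \<psi>) \<in> Mpairs \<and> \<phi> = id}"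

definition Gres :: "(('c \<times> 'v) option \<Rightarrow> ('c \<times> 'v) option) set" where
  "Gres =
     {n1 \<circ> sigmaD \<circ> m \<circ> a \<circ> n2 |n1 m a n2. n1 \<in> Ngrp \<and> m \<in> Mres \<and> a \<in> Agrp \<and> n2 \<in> Ngrp} \<union>
     {m \<circ> a \<circ> n |m a n. m \<in> Mres \<and> a \<in> Agrp \<and> n \<in> Ngrp}"

text \<open>The stabilizer of \<open>\<infinity>\<close> in \<open>\<Gamma>\<close>.\<close>

definition stab_inf ::
  "(('c \<times> 'v) option \<Rightarrow> ('c \<times> 'v) option) set \<Rightarrow> (('c \<times> 'v) option \<Rightarrow> ('c \<times> 'v) option) set" where
  "stab_inf \<Gamma> = {g \<in> \<Gamma>. g None = None}"


subsection \<open>The model \<open>H\<close> and the action of \<open>G\<close> on its closure\<close>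

definition Hdom :: "('c \<times> 'v) set" where
  "Hdom = {(\<zeta>, v). reC \<zeta> > 1/2 * (norm v)\<^sup>2}"

definition Hbar :: "('c \<times> 'v) option set" where
  "Hbar = Some ` {(\<zeta>, v). reC \<zeta> \<ge> 1/2 * (norm v)\<^sup>2} \<union> {None}"

definition Hbar_top :: "('c \<times> 'v) option topology" where
  "Hbar_top = subtopology (Alexandroff_compactification euclidean) Hbar"

definition bdryH :: "('c \<times> 'v) option set" where
  "bdryH = Hbar - Some ` Hdom"

text \<open>\<open>betaHD\<close> is a bijection of the whole one-point compactification, carrying \<open>Hbar\<close> onto
  \<open>Dbar\<close> and \<open>H\<close> onto \<open>D\<close>.\<close>

definition betaHD :: "('c \<times> 'v) option \<Rightarrow> ('c \<times> 'v) option" where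
  "betaHD = map_option (\<lambda>(\<zeta>, v). (\<zeta>, sqrt 2 *\<^sub>R v))"

definition actHbar ::
  "(('c \<times> 'v) option \<Rightarrow> ('c \<times> 'v) option) \<Rightarrow> ('c \<times> 'v) option \<Rightarrow> ('c \<times> 'v) option" where
  "actHbar g = inv_into UNIV betaHD \<circ> g \<circ> betaHD"

definition actH :: "(('c \<times> 'v) option \<Rightarrow> ('c \<times> 'v) option) \<Rightarrow> 'c \<times> 'v \<Rightarrow> 'c \<times> 'v" where
  "actH g z = the (actHbar g (Some z))"


section \<open>Isometric spheres\<close>

definition htH :: "'c \<times> 'v \<Rightarrow> real" where
  "htH = (\<lambda>(\<zeta>, v). reC \<zeta> - 1/2 * (norm v)\<^sup>2)"

definition cygan :: "'c \<times> 'v \<Rightarrow> 'c \<times> 'v \<Rightarrow> real" where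
  "cygan = (\<lambda>(\<zeta>1, v1) (\<zeta>2, v2).
     sqrt (norm ((1/2 * (norm v1)\<^sup>2 + 1/2 * (norm v2)\<^sup>2 + \<bar>htH (\<zeta>1, v1) - htH (\<zeta>2, v2)\<bar>) *\<^sub>R unitC
       + imC \<zeta>1 - imC \<zeta>2 - beta2 v1 v2)))"

definition radius :: "(('c \<times> 'v) option \<Rightarrow> ('c \<times> 'v) option) \<Rightarrow> real" where
  "radius g = (THE r. \<exists>n1\<in>Ngrp. \<exists>m\<in>Mgrp. \<exists>t>0. \<exists>n2\<in>Ngrp.
     g = n1 \<circ> sigmaD \<circ> m \<circ> aD t \<circ> n2 \<and> r = t powr (- 1/4))"

text \<open>\<open>centre g\<close> is the point \<open>g\<^sup>-\<^sup>1\<infinity>\<close> of \<open>Hbar\<close>, which is finite if \<open>g\<close> does not fix \<open>\<infinity>\<close>.\<close>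

definition centre :: "(('c \<times> 'v) option \<Rightarrow> ('c \<times> 'v) option) \<Rightarrow> 'c \<times> 'v" where
  "centre g = the (actHbar (inv_into UNIV g) None)"

definition isom_sphere :: "(('c \<times> 'v) option \<Rightarrow> ('c \<times> 'v) option) \<Rightarrow> ('c \<times> 'v) set" where
  "isom_sphere g = {z \<in> Hdom. cygan z (centre g) = radius g}"

definition ext_sphere :: "(('c \<times> 'v) option \<Rightarrow> ('c \<times> 'v) option) \<Rightarrow> ('c \<times> 'v) set" where
  "ext_sphere g = {z \<in> Hdom. cygan z (centre g) > radius g}"

definition int_sphere :: "(('c \<times> 'v) option \<Rightarrow> ('c \<times> 'v) option) \<Rightarrow> ('c \<times> 'v) set" where
  "int_sphere g = {z \<in> Hdom. cygan z (centre g) < radius g}"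

text \<open>Intersecting with \<open>Hdom\<close> makes the intersection over the empty index set equal to \<open>H\<close>.\<close>

definition common_exterior :: "(('c \<times> 'v) option \<Rightarrow> ('c \<times> 'v) option) set \<Rightarrow> ('c \<times> 'v) set" where
  "common_exterior \<Gamma> = Hdom \<inter> (\<Inter>g\<in>\<Gamma> - stab_inf \<Gamma>. ext_sphere g)"


section \<open>Types, fundamental domains, discontinuity\<close>

definition type_O :: "(('c \<times> 'v) option \<Rightarrow> ('c \<times> 'v) option) set \<Rightarrow> bool" where
  "type_O \<Gamma> \<longleftrightarrow> common_exterior \<Gamma> =
     Hdom - (top_of_set Hdom closure_of (\<Union>g\<in>\<Gamma> - stab_inf \<Gamma>. int_sphere g))"

definition type_F :: "(('c \<times> 'v) option \<Rightarrow> ('c \<times> 'v) option) set \<Rightarrow> bool" where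
  "type_F T \<longleftrightarrow> T \<subseteq> carrier Ggrp \<and>
     (\<forall>z\<in>Hdom. \<exists>g\<in>generate Ggrp T. \<forall>h\<in>generate Ggrp T. htH (actH h z) \<le> htH (actH g z))"

definition fundamental_domain ::
  "(('c \<times> 'v) option \<Rightarrow> ('c \<times> 'v) option) set \<Rightarrow> ('c \<times> 'v) set \<Rightarrow> bool" where
  "fundamental_domain \<Gamma> Y \<longleftrightarrow>
     Y \<subseteq> Hdom \<and> open Y \<and> connected Y \<and>
     (\<forall>g\<in>\<Gamma>. \<forall>h\<in>\<Gamma>. g \<noteq> h \<longrightarrow> actH g ` Y \<inter> actH h ` Y = {}) \<and>
     Hdom = (\<Union>g\<in>\<Gamma>. actH g ` (top_of_set Hdom closure_of Y))"

definition properly_discontinuous :: "(('c \<times> 'v) option \<Rightarrow> ('c \<times> 'v) option) set \<Rightarrow> bool" where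
  "properly_discontinuous \<Gamma> \<longleftrightarrow>
     (\<forall>K. compact K \<and> K \<subseteq> Hdom \<longrightarrow> finite {g \<in> \<Gamma>. K \<inter> actH g ` K \<noteq> {}})"

text \<open>The accumulation points of an orbit do not depend on the orbit. Quantifying universally over
  the base point makes \<open>p \<in> Omega \<Gamma>\<close> mean that \<open>p\<close> fails to be an accumulation point of at least
  one orbit.\<close>

definition limit_set :: "(('c \<times> 'v) option \<Rightarrow> ('c \<times> 'v) option) set \<Rightarrow> ('c \<times> 'v) option set" where
  "limit_set \<Gamma> = {p. \<forall>z\<in>Hdom. p \<in> Hbar_top derived_set_of {actHbar g (Some z) |g. g \<in> \<Gamma>}}"

definition Omega :: "(('c \<times> 'v) option \<Rightarrow> ('c \<times> 'v) option) set \<Rightarrow> ('c \<times> 'v) option set" where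
  "Omega \<Gamma> = bdryH - limit_set \<Gamma>"

end

end

theory Submission
  imports Defs
begin

text \<open>
  Everything rests on reading isometric spheres as comparisons of heights. Put
  \<open>q(z, w) = \<zeta>\<^sub>z + cnj \<zeta>\<^sub>w - \<beta>\<^sub>2(v\<^sub>z, v\<^sub>w)\<close>, the polarization of twice the height. If
  \<open>g = n\<^sub>1 \<sigma> m a\<^sub>t n\<^sub>2\<close> and \<open>c = g\<^sup>-\<^sup>1\<infinity>\<close>, then \<open>ht(gz) t |q(z, c)|\<^sup>2 = ht(z)\<close>, while \<open>|q(z, c)|\<close> is the square
  of the Cygan distance from \<open>z\<close> to \<open>c\<close>. Hence the exterior of the isometric sphere of \<open>g\<close> consists
  of the points that \<open>g\<close> lowers, the interior of those that it raises, and the common exterior \<open>F\<close> of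
  the points that every nontrivial element of \<open>\<Gamma>\<close> lowers. A nontrivial \<open>k\<close> cannot move a point \<open>z\<close> of \<open>F\<close>
  to a point of \<open>F\<close>, because then \<open>k\<close> lowers \<open>z\<close> and its inverse lowers \<open>kz\<close>; so the translates
  of \<open>F\<close> are disjoint.

  The remaining claims follow from two facts. The first is local finiteness: all but
  finitely many elements of \<open>\<Gamma>\<close> lower every point of a given compact set \<open>K\<close> (\<open>finite_nonexterior\<close>). Because infinity is
  not a limit point, some orbit is bounded. The quotient \<open>|q(z, w)|\<^sup>2 / (ht z ht w)\<close> is invariant
  (\<open>Gres_preserves_ratio\<close>) and plays the part of the distance: it carries the bound over to the union of
  the translates of \<open>K\<close>. The part of a bounded set above a positive height lies in a compact subset
  of \<open>H\<close>, and proper discontinuity applies. Invariance under \<open>\<sigma>\<close> is where associativity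
  enters, through the sesquilinearity of \<open>\<beta>\<^sub>2\<close> over \<open>C\<close> (\<open>herm_J\<close>).

  The second fact is that going straight up strictly increases \<open>|q(z, c)|\<close> for every boundary point
  \<open>c\<close> (\<open>lift_exterior\<close>). So a point that is highest in its orbit, but perhaps not strictly, is
  a limit of points of \<open>F\<close>, which together with the existence of highest points shows that the
  translates of the closure of \<open>F\<close> cover \<open>H\<close>. Going straight down from a point outside \<open>F\<close> enters an
  interior, which gives type (O). Finally \<open>F\<close> is stable under going up, and above a compact set it
  contains every point that is high enough, which makes \<open>F\<close> connected.
\<close>

section \<open>Associative module structures\<close>

locale associative_J2C =
  fixes J :: "'c::euclidean_space \<Rightarrow> 'v::euclidean_space \<Rightarrow> 'v"
  assumes J2C: "J2C_module J" and assoc: "J2C_associative J"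
begin

abbreviation e :: 'c where "e \<equiv> unitC J"
abbreviation cnj :: "'c \<Rightarrow> 'c" where "cnj \<equiv> conjC J"
abbreviation herm :: "'v \<Rightarrow> 'v \<Rightarrow> 'c" where "herm \<equiv> beta2 J"

lemma norm_J: "norm (J \<zeta> v) = norm \<zeta> * norm v"
  using J2C unfolding J2C_module_def by blast

lemma bilinear_J: "bilinear J"
  using J2C unfolding J2C_module_def by blast

lemma linear_J_left: "linear (\<lambda>\<zeta>. J \<zeta> v)"
  using bilinear_J unfolding bilinear_def by auto

lemmas J_simps =
  bilinear_ladd[OF bilinear_J] bilinear_radd[OF bilinear_J]
  bilinear_lsub[OF bilinear_J] bilinear_rsub[OF bilinear_J]
  bilinear_lmul[OF bilinear_J] bilinear_rmul[OF bilinear_J]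
  bilinear_lneg[OF bilinear_J] bilinear_rneg[OF bilinear_J]
  bilinear_lzero[OF bilinear_J] bilinear_rzero[OF bilinear_J]

lemma unit_vector: obtains v :: 'v where "norm v = 1"
  using nonempty_Basis norm_Basis by fastforce

lemma J_eq_0_iff: "J \<zeta> v = 0 \<longleftrightarrow> \<zeta> = 0 \<or> v = 0"
  by (metis mult_eq_0_iff norm_J norm_eq_zero)

lemma J_cancel: "v \<noteq> 0 \<Longrightarrow> J \<zeta> v = J \<eta> v \<longleftrightarrow> \<zeta> = \<eta>"
  using J_eq_0_iff[of "\<zeta> - \<eta>" v] by (simp add: J_simps)

lemma J_eqI: "(\<And>v. J \<zeta> v = J \<eta> v) \<Longrightarrow> \<zeta> = \<eta>"
  using J_cancel unit_vector by (metis norm_zero zero_neq_one)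

lemma J_e [simp]: "J e v = v"
proof -
  obtain e' where e': "e' \<noteq> 0 \<and> (\<forall>v. J e' v = v)"
    using J2C unfolding J2C_module_def by blast
  have "e \<noteq> 0 \<and> (\<forall>v. J e v = v)"
    unfolding unitC_def by (rule theI[of _ e']) (use e' J_eqI in auto)
  then show ?thesis by blast
qed

lemma norm_e [simp]: "norm e = 1"
proof -
  obtain v :: 'v where "norm v = 1" by (rule unit_vector)
  then show ?thesis using norm_J[of e v] by simp
qed

lemma e_nonzero [simp]: "e \<noteq> 0"
  using norm_e by force

lemma e_inner_e [simp]: "e \<bullet> e = 1"
  by (simp add: dot_square_norm)

subsection \<open>Conjugation is transposition\<close>

text \<open>The next two identities are the polarizations of the norm identity \<open>|\<zeta>v| = |\<zeta>||v|\<close>.\<close>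

lemma J_inner_right: "J \<zeta> x \<bullet> J \<zeta> y = (norm \<zeta>)\<^sup>2 * (x \<bullet> y)"
proof -
  have "(norm (J \<zeta> (x + y)))\<^sup>2 = (norm \<zeta>)\<^sup>2 * (norm (x + y))\<^sup>2"
    "(norm (J \<zeta> x))\<^sup>2 = (norm \<zeta>)\<^sup>2 * (norm x)\<^sup>2" "(norm (J \<zeta> y))\<^sup>2 = (norm \<zeta>)\<^sup>2 * (norm y)\<^sup>2"
    by (simp_all add: norm_J power_mult_distrib)
  then show ?thesis
    unfolding power2_norm_eq_inner J_simps inner_add_left inner_add_right
    by (simp add: inner_commute algebra_simps)
qed

lemma J_inner_left: "J \<zeta> v \<bullet> J \<eta> v = (\<zeta> \<bullet> \<eta>) * (norm v)\<^sup>2"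
proof -
  have "(norm (J (\<zeta> + \<eta>) v))\<^sup>2 = (norm (\<zeta> + \<eta>))\<^sup>2 * (norm v)\<^sup>2"
    "(norm (J \<zeta> v))\<^sup>2 = (norm \<zeta>)\<^sup>2 * (norm v)\<^sup>2" "(norm (J \<eta> v))\<^sup>2 = (norm \<eta>)\<^sup>2 * (norm v)\<^sup>2"
    by (simp_all add: norm_J power_mult_distrib)
  then show ?thesis
    unfolding power2_norm_eq_inner J_simps inner_add_left inner_add_right
    by (simp add: inner_commute algebra_simps)
qed

lemma conjC_eq: "cnj \<zeta> = (2 * (\<zeta> \<bullet> e)) *\<^sub>R e - \<zeta>"
  unfolding conjC_def imC_def reC_def mult_2 scaleR_add_left by simp

lemma cnj_cnj [simp]: "cnj (cnj \<zeta>) = \<zeta>"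
  by (simp add: conjC_eq inner_diff_left)

lemma cnj_e [simp]: "cnj e = e"
  by (simp add: conjC_eq scaleR_2)

lemma cnj_inner: "cnj \<zeta> \<bullet> \<eta> = \<zeta> \<bullet> cnj \<eta>"
  by (simp add: conjC_eq inner_diff_left inner_diff_right inner_commute)

lemma norm_cnj [simp]: "norm (cnj \<zeta>) = norm \<zeta>"
  by (simp add: norm_eq cnj_inner)

lemma cnj_add: "cnj (\<zeta> + \<eta>) = cnj \<zeta> + cnj \<eta>"
  and cnj_scaleR: "cnj (r *\<^sub>R \<zeta>) = r *\<^sub>R cnj \<zeta>"
  and cnj_0 [simp]: "cnj 0 = 0"
  by (simp_all add: conjC_eq inner_add_left inner_diff_left algebra_simps)

lemma reC_cnj [simp]: "reC J (cnj \<zeta>) = reC J \<zeta>"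
  by (simp add: reC_def cnj_inner)

lemma J_adjoint: "J \<zeta> x \<bullet> y = x \<bullet> J (cnj \<zeta>) y"
proof -
  have "(norm (\<zeta> + e))\<^sup>2 = (norm \<zeta>)\<^sup>2 + 2 * (\<zeta> \<bullet> e) + 1"
    by (simp add: power2_norm_eq_inner inner_add_left inner_add_right inner_commute)
  then have "J \<zeta> x \<bullet> y + x \<bullet> J \<zeta> y = 2 * (\<zeta> \<bullet> e) * (x \<bullet> y)"
    using J_inner_right[of "\<zeta> + e" x y] J_inner_right[of \<zeta> x y]
    by (simp add: J_simps inner_add_left inner_add_right algebra_simps)
  then show ?thesis
    by (simp add: conjC_eq J_simps inner_diff_right algebra_simps)
qed

lemma J_cnj_J: "J (cnj \<zeta>) (J \<zeta> v) = (norm \<zeta>)\<^sup>2 *\<^sub>R v"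
proof -
  have "y \<bullet> J (cnj \<zeta>) (J \<zeta> v) = y \<bullet> ((norm \<zeta>)\<^sup>2 *\<^sub>R v)" for y
    by (simp add: J_adjoint[symmetric] J_inner_right)
  then show ?thesis
    using vector_eq_ldot by blast
qed

subsection \<open>The product on \<open>C\<close>\<close>

lemma J2_ex: "\<exists>\<kappa>. J \<zeta> (J \<eta> v) = J \<kappa> v"
proof -
  have "J \<zeta> (J \<eta> v) \<in> {J \<zeta> (J \<eta> v) |\<zeta> \<eta>. True}" by blast
  also have "\<dots> = {J \<zeta> v |\<zeta>. True}"
    using J2C unfolding J2C_module_def by blast
  finally show ?thesis by blast
qed

lemma J_mult_at:
  assumes "v \<noteq> 0"
  shows "J (mult_at J v \<zeta> \<eta>) v = J \<zeta> (J \<eta> v)"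
proof -
  obtain \<kappa> where "J \<zeta> (J \<eta> v) = J \<kappa> v" using J2_ex by blast
  then show ?thesis
    unfolding mult_at_def by (rule theI2) (use \<open>J \<zeta> (J \<eta> v) = J \<kappa> v\<close> J_cancel[OF assms] in auto)
qed

text \<open>If the product read off at \<open>v\<close> is associative, it describes the action on the submodule
  \<open>W = Cv\<close>. For \<open>u\<close> orthogonal to \<open>W\<close>, the element of \<open>C\<close> that acts on \<open>v + u\<close> as \<open>\<zeta>\<eta>\<close> is
  determined by its action on the component \<open>v\<close>, so the same product also describes the action on
  the complement of \<open>W\<close>.\<close>

lemma uniform_product: "\<exists>\<kappa>. \<forall>v. J \<zeta> (J \<eta> v) = J \<kappa> v"
proof -
  obtain v where v: "v \<noteq> 0"
    and as: "\<And>\<zeta> \<eta> \<kappa>. mult_at J v (mult_at J v \<zeta> \<eta>) \<kappa> = mult_at J v \<zeta> (mult_at J v \<eta> \<kappa>)"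
    using assoc unfolding J2C_associative_def by blast
  define p where "p = mult_at J v \<zeta> \<eta>"
  define W where "W = range (\<lambda>\<xi>. J \<xi> v)"
  have W: "subspace W"
    unfolding W_def by (intro linear_subspace_image linear_J_left subspace_UNIV)
  have onW: "J \<zeta> (J \<eta> w) = J p w" if "w \<in> W" for w
  proof -
    obtain \<kappa> where w: "w = J \<kappa> v" using \<open>w \<in> W\<close> unfolding W_def by blast
    have "J \<zeta> (J \<eta> w) = J (mult_at J v \<zeta> (mult_at J v \<eta> \<kappa>)) v"
      by (simp add: w J_mult_at v)
    also have "\<dots> = J p w"
      unfolding as[symmetric] p_def[symmetric] by (simp add: w J_mult_at v)
    finally show ?thesis .
  qed
  have invW: "J \<xi> w \<in> W" if "w \<in> W" for \<xi> w
    using that J2_ex[of \<xi>] unfolding W_def by (auto simp: image_iff)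
  have invP: "\<forall>w\<in>W. orthogonal (J \<xi> u) w" if "\<forall>w\<in>W. orthogonal u w" for \<xi> u
    using that invW by (simp add: orthogonal_def J_adjoint)
  have vW: "v \<in> W"
    unfolding W_def using J_e[of v, symmetric] by (rule range_eqI)
  have onP: "J \<zeta> (J \<eta> u) = J p u" if u: "\<forall>w\<in>W. orthogonal u w" for u
  proof -
    obtain \<kappa> where k: "J \<zeta> (J \<eta> (v + u)) = J \<kappa> (v + u)" using J2_ex by blast
    define d where "d = J p v - J \<kappa> v"
    have d: "d = J \<kappa> u - J \<zeta> (J \<eta> u)"
      using k onW[OF vW] by (simp add: d_def J_simps algebra_simps)
    have "d \<in> W"
      unfolding d_def by (intro subspace_diff W invW vW)
    moreover have "\<forall>w\<in>W. orthogonal d w"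
      unfolding d using invP[OF invP[OF u]] invP[OF u]
      by (simp add: orthogonal_def inner_diff_left)
    ultimately have "d = 0"
      using orthogonal_self by blast
    then show ?thesis
      using d d_def J_cancel[OF v] by auto
  qed
  have "J \<zeta> (J \<eta> x) = J p x" for x
  proof -
    obtain y z where "y \<in> span W" "\<And>w. w \<in> span W \<Longrightarrow> orthogonal z w" "x = y + z"
      using orthogonal_subspace_decomp_exists[of W x] by blast
    then have "y \<in> W" "\<forall>w\<in>W. orthogonal z w" "x = y + z"
      unfolding span_eq_iff[THEN iffD2, OF W] by auto
    then show ?thesis
      using onW onP by (simp add: J_simps)
  qed
  then show ?thesis by blast
qed

text \<open>The product of the associative algebra \<open>C\<close>, through which \<open>C\<close> acts on every vector.\<close>

definition prodC :: "'c \<Rightarrow> 'c \<Rightarrow> 'c" where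
  "prodC \<zeta> \<eta> = (SOME \<kappa>. \<forall>v. J \<zeta> (J \<eta> v) = J \<kappa> v)"

lemma J_prodC [simp]: "J (prodC \<zeta> \<eta>) v = J \<zeta> (J \<eta> v)"
  unfolding prodC_def by (rule someI_ex[OF uniform_product, THEN spec, symmetric])

lemma prodC_e [simp]: "prodC e \<zeta> = \<zeta>" "prodC \<zeta> e = \<zeta>"
  by (rule J_eqI; simp)+

lemma prodC_assoc: "prodC (prodC \<zeta> \<eta>) \<kappa> = prodC \<zeta> (prodC \<eta> \<kappa>)"
  by (rule J_eqI) simp

lemma prodC_simps:
  "prodC (\<zeta> + \<eta>) \<kappa> = prodC \<zeta> \<kappa> + prodC \<eta> \<kappa>" "prodC \<zeta> (\<eta> + \<kappa>) = prodC \<zeta> \<eta> + prodC \<zeta> \<kappa>"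
  "prodC (\<zeta> - \<eta>) \<kappa> = prodC \<zeta> \<kappa> - prodC \<eta> \<kappa>" "prodC \<zeta> (\<eta> - \<kappa>) = prodC \<zeta> \<eta> - prodC \<zeta> \<kappa>"
  "prodC (r *\<^sub>R \<zeta>) \<kappa> = r *\<^sub>R prodC \<zeta> \<kappa>" "prodC \<zeta> (r *\<^sub>R \<kappa>) = r *\<^sub>R prodC \<zeta> \<kappa>"
  by (rule J_eqI; simp add: J_simps)+

lemma norm_prodC: "norm (prodC \<zeta> \<eta>) = norm \<zeta> * norm \<eta>"
proof -
  obtain v :: 'v where "norm v = 1" by (rule unit_vector)
  then show ?thesis
    using norm_J[of "prodC \<zeta> \<eta>" v] by (simp add: norm_J)
qed

lemma prodC_cnj: "prodC (cnj \<zeta>) \<zeta> = (norm \<zeta>)\<^sup>2 *\<^sub>R e" "prodC \<zeta> (cnj \<zeta>) = (norm \<zeta>)\<^sup>2 *\<^sub>R e"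
  using J_cnj_J[of \<zeta>] J_cnj_J[of "cnj \<zeta>"] by (auto intro!: J_eqI simp: J_simps)

lemma inner_prodC_left: "prodC \<zeta> \<eta> \<bullet> \<kappa> = \<eta> \<bullet> prodC (cnj \<zeta>) \<kappa>"
proof -
  obtain v :: 'v where v: "norm v = 1" by (rule unit_vector)
  have "prodC \<zeta> \<eta> \<bullet> \<kappa> = J \<zeta> (J \<eta> v) \<bullet> J \<kappa> v"
    using J_inner_left[of "prodC \<zeta> \<eta>" v \<kappa>] v by simp
  also have "\<dots> = J \<eta> v \<bullet> J (prodC (cnj \<zeta>) \<kappa>) v"
    by (simp add: J_adjoint)
  also have "\<dots> = \<eta> \<bullet> prodC (cnj \<zeta>) \<kappa>"
    by (simp only: J_inner_left v) simp
  finally show ?thesis .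
qed

text \<open>Conjugation is transposition on \<open>V\<close>, hence reverses products.\<close>

lemma cnj_prodC: "cnj (prodC \<zeta> \<eta>) = prodC (cnj \<eta>) (cnj \<zeta>)"
proof (rule J_eqI)
  fix v
  have "y \<bullet> J (cnj (prodC \<zeta> \<eta>)) v = y \<bullet> J (prodC (cnj \<eta>) (cnj \<zeta>)) v" for y
    by (simp add: J_adjoint[symmetric])
  then show "J (cnj (prodC \<zeta> \<eta>)) v = J (prodC (cnj \<eta>) (cnj \<zeta>)) v"
    using vector_eq_ldot by blast
qed

lemma inner_prodC_right: "prodC \<zeta> \<eta> \<bullet> \<kappa> = \<zeta> \<bullet> prodC \<kappa> (cnj \<eta>)"
proof -
  have "prodC \<zeta> \<eta> \<bullet> \<kappa> = cnj (prodC \<zeta> \<eta>) \<bullet> cnj \<kappa>"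
    by (simp add: cnj_inner)
  also have "\<dots> = cnj \<zeta> \<bullet> prodC \<eta> (cnj \<kappa>)"
    by (simp only: cnj_prodC inner_prodC_left cnj_cnj)
  also have "\<dots> = \<zeta> \<bullet> prodC \<kappa> (cnj \<eta>)"
    by (simp only: cnj_inner cnj_prodC cnj_cnj)
  finally show ?thesis .
qed

subsection \<open>The Hermitian form\<close>

lemma inner_eqI: "(\<And>\<kappa>. x \<bullet> \<kappa> = y \<bullet> \<kappa>) \<Longrightarrow> x = (y :: 'c)"
  using vector_eq_rdot by blast

lemma herm_inner: "herm v u \<bullet> \<zeta> = J \<zeta> u \<bullet> v"
proof -
  have ex: "\<forall>\<zeta>. adjoint (\<lambda>\<zeta>. J \<zeta> u) v \<bullet> \<zeta> = J \<zeta> u \<bullet> v"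
    using adjoint_works[OF linear_J_left] by (metis inner_commute)
  have "\<forall>\<zeta>. herm v u \<bullet> \<zeta> = J \<zeta> u \<bullet> v"
    unfolding beta2_def
    by (rule theI[of _ "adjoint (\<lambda>\<zeta>. J \<zeta> u) v"]) (use ex in \<open>auto intro!: inner_eqI\<close>)
  then show ?thesis by blast
qed

lemma bilinear_herm: "bilinear herm"
  unfolding bilinear_def
  by (auto intro!: linearI inner_eqI
      simp: herm_inner J_simps inner_add_left inner_add_right)

lemmas herm_simps =
  bilinear_ladd[OF bilinear_herm] bilinear_radd[OF bilinear_herm]
  bilinear_lsub[OF bilinear_herm] bilinear_rsub[OF bilinear_herm]
  bilinear_lmul[OF bilinear_herm] bilinear_rmul[OF bilinear_herm]
  bilinear_lneg[OF bilinear_herm] bilinear_rneg[OF bilinear_herm]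
  bilinear_lzero[OF bilinear_herm] bilinear_rzero[OF bilinear_herm]

lemma reC_herm [simp]: "reC J (herm v u) = v \<bullet> u"
  by (simp add: reC_def herm_inner inner_commute[of u])

lemma cnj_herm: "cnj (herm v u) = herm u v"
proof (rule inner_eqI)
  fix \<kappa>
  have "cnj (herm v u) \<bullet> \<kappa> = J (cnj \<kappa>) u \<bullet> v"
    by (simp add: cnj_inner herm_inner)
  also have "\<dots> = herm u v \<bullet> \<kappa>"
    by (simp only: J_adjoint[of _ u] cnj_cnj herm_inner) (rule inner_commute)
  finally show "cnj (herm v u) \<bullet> \<kappa> = herm u v \<bullet> \<kappa>" .
qed

lemma herm_self: "herm v v = (norm v)\<^sup>2 *\<^sub>R e"
proof (rule inner_eqI)
  fix \<kappa>
  show "herm v v \<bullet> \<kappa> = ((norm v)\<^sup>2 *\<^sub>R e) \<bullet> \<kappa>"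
    using J_inner_left[of \<kappa> v e] by (simp add: herm_inner inner_commute[of e])
qed

text \<open>The form is sesquilinear over \<open>C\<close>: the factors move across the inner product as their
  conjugates. The two vectors are unrelated, so a product describing the action at all vectors at once
  is essential.\<close>

lemma herm_J: "herm (J \<zeta> v) (J \<eta> u) = prodC \<zeta> (prodC (herm v u) (cnj \<eta>))"
proof (rule inner_eqI)
  fix \<kappa>
  have "herm (J \<zeta> v) (J \<eta> u) \<bullet> \<kappa> = J (prodC (prodC (cnj \<zeta>) \<kappa>) \<eta>) u \<bullet> v"
    by (simp add: herm_inner J_adjoint[of "cnj \<zeta>"])
  also have "\<dots> = herm v u \<bullet> prodC (prodC (cnj \<zeta>) \<kappa>) \<eta>"
    by (simp add: herm_inner)
  also have "\<dots> = prodC \<zeta> (prodC (herm v u) (cnj \<eta>)) \<bullet> \<kappa>"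
    by (simp only: inner_prodC_left[of \<zeta>] inner_prodC_right[of "herm v u"] cnj_cnj)
  finally show "herm (J \<zeta> v) (J \<eta> u) \<bullet> \<kappa> = prodC \<zeta> (prodC (herm v u) (cnj \<eta>)) \<bullet> \<kappa>" .
qed

lemma norm_herm_le: "norm (herm v u) \<le> norm v * norm u"
proof -
  have "(norm (herm v u))\<^sup>2 = J (herm v u) u \<bullet> v"
    by (simp add: power2_norm_eq_inner herm_inner)
  also have "\<dots> \<le> norm (herm v u) * (norm v * norm u)"
    using norm_cauchy_schwarz[of "J (herm v u) u" v] by (simp add: norm_J mult_ac)
  finally show ?thesis
    by (cases "herm v u = 0") (auto simp: power2_eq_square)
qed

section \<open>The action on the Siegel domain \<open>D\<close>\<close>

definition htD :: "'c \<times> 'v \<Rightarrow> real" where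
  "htD p = reC J (fst p) - 1/4 * (norm (snd p))\<^sup>2"

text \<open>The polarization of twice the height, see \<open>pol_self\<close>. Group elements change its norm only by
  a product of a factor depending on \<open>p\<close> and a factor depending on \<open>p'\<close>.\<close>

definition pol :: "'c \<times> 'v \<Rightarrow> 'c \<times> 'v \<Rightarrow> 'c" where
  "pol p p' = fst p + cnj (fst p') - (1/2) *\<^sub>R herm (snd p) (snd p')"

lemma reC_simps:
  "reC J (\<zeta> + \<eta>) = reC J \<zeta> + reC J \<eta>" "reC J (\<zeta> - \<eta>) = reC J \<zeta> - reC J \<eta>"
  "reC J (r *\<^sub>R \<zeta>) = r * reC J \<zeta>" "reC J e = 1"
  by (simp_all add: reC_def inner_add_left inner_diff_left)

lemma abs_reC_le: "\<bar>reC J \<zeta>\<bar> \<le> norm \<zeta>"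
  unfolding reC_def using Cauchy_Schwarz_ineq2[of \<zeta> e] by simp

lemma Ddom_iff: "p \<in> Ddom J \<longleftrightarrow> 0 < htD p"
  by (cases p) (simp add: Ddom_def htD_def)

lemma Some_in_Dbar_iff: "Some p \<in> Dbar J \<longleftrightarrow> 0 \<le> htD p"
  by (cases p) (auto simp: Dbar_def htD_def)

lemma cnj_plus_self: "\<zeta> + cnj \<zeta> = (2 * reC J \<zeta>) *\<^sub>R e"
  by (simp add: conjC_eq reC_def)

lemma pol_self: "pol p p = (2 * htD p) *\<^sub>R e"
  unfolding pol_def cnj_plus_self herm_self htD_def
  by (simp add: right_diff_distrib scaleR_left_diff_distrib)

lemma pol_zero: "pol p 0 = fst p"
  by (simp add: pol_def herm_simps)

lemma reC_pol: "reC J (pol p p') = htD p + htD p' + 1/4 * (norm (snd p - snd p'))\<^sup>2"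
  by (simp add: pol_def htD_def reC_simps power2_norm_eq_inner inner_diff_left inner_diff_right
      inner_commute algebra_simps)

lemma pol_nonzero:
  assumes "0 < htD p" "0 \<le> htD p'"
  shows "pol p p' \<noteq> 0"
proof
  assume "pol p p' = 0"
  then have "htD p + htD p' + 1/4 * (norm (snd p - snd p'))\<^sup>2 = 0"
    using reC_pol[of p p'] by (simp add: reC_def)
  moreover have "0 \<le> 1/4 * (norm (snd p - snd p'))\<^sup>2"
    by simp
  ultimately show False
    using assms by linarith
qed

text \<open>The behaviour of the height is read off from that of its polarization on the diagonal.\<close>

lemma htD_scaled:
  assumes "pol q q = r *\<^sub>R pol p p"
  shows "htD q = r * htD p"
  using arg_cong[OF assms, of "reC J"] by (simp add: pol_self reC_simps)

subsection \<open>Similarities: the groups \<open>N\<close>, \<open>A\<close>, \<open>M\<close>\<close>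

text \<open>What matters about an element \<open>m a\<^sub>k n\<close>. Its formula makes sense on all of \<open>C \<oplus> V\<close>, so the
  identities for \<open>f\<close> are stated for all points. The point \<open>c\<close> that goes to \<open>0\<close>, and from there
  to infinity under \<open>\<sigma>\<close>, becomes the centre of an isometric sphere.\<close>

definition similarity :: "real \<Rightarrow> (('c \<times> 'v) option \<Rightarrow> ('c \<times> 'v) option) \<Rightarrow> bool" where
  "similarity k h \<longleftrightarrow> h None = None \<and>
     (\<exists>f. (\<forall>p. 0 \<le> htD p \<longrightarrow> h (Some p) = Some (f p)) \<and>
          (\<forall>p. htD (f p) = k * htD p) \<and>
          (\<forall>p p'. norm (pol (f p) (f p')) = k * norm (pol p p')) \<and>
          (\<exists>c. f c = 0))"

lemma similarity_nD:
  assumes "Z \<in> Cprime J"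
  shows "similarity 1 (nD J Z X)"
proof -
  define f where
    "f p = ((1/4 * (norm X)\<^sup>2) *\<^sub>R e + Z + fst p + (1/2) *\<^sub>R herm (snd p) X, X + snd p)" for p
  have cZ: "cnj Z = - Z"
    using assms by (simp add: Cprime_def orthogonal_def conjC_eq inner_commute)
  have pol: "pol (f p) (f p') = pol p p'" for p p'
  proof -
    \<comment> \<open>The two real parts added by the translation cancel the term \<open>1/2 herm X X\<close> of the expansion.\<close>
    have "(1/4 * (norm X)\<^sup>2) *\<^sub>R e + (1/4 * (norm X)\<^sup>2) *\<^sub>R e = (1/2) *\<^sub>R herm X X"
      by (simp add: herm_self flip: scaleR_add_left)
    then show ?thesis
      by (simp add: pol_def f_def cnj_add cnj_scaleR cnj_herm cZ herm_simps scaleR_add_right)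
  qed
  have "htD (f p) = 1 * htD p" for p
    by (rule htD_scaled) (simp add: pol)
  moreover have "f ((1/4 * (norm X)\<^sup>2) *\<^sub>R e - Z, - X) = 0"
    by (simp add: f_def herm_simps herm_self zero_prod_def flip: scaleR_add_left)
  moreover have "nD J Z X (Some p) = Some (f p)" if "0 \<le> htD p" for p
    using that by (cases p) (simp add: nD_def ext_Dbar_def Some_in_Dbar_iff f_def)
  moreover have "nD J Z X None = None"
    by (simp add: nD_def ext_Dbar_def)
  ultimately show ?thesis
    unfolding similarity_def using pol by (intro conjI exI[of _ f]) auto
qed

lemma similarity_aD:
  assumes "t > 0"
  shows "similarity t (aD J t)"
proof -
  define f where "f p = (t *\<^sub>R fst p, sqrt t *\<^sub>R snd p)" for p :: "'c \<times> 'v"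
  have pol: "pol (f p) (f p') = t *\<^sub>R pol p p'" for p p'
    using assms by (simp add: pol_def f_def cnj_scaleR herm_simps algebra_simps)
  have "htD (f p) = t * htD p" for p
    by (rule htD_scaled) (simp add: pol)
  moreover have "f 0 = 0"
    by (simp add: f_def zero_prod_def)
  moreover have "aD J t (Some p) = Some (f p)" if "0 \<le> htD p" for p
    using that by (cases p) (simp add: aD_def ext_Dbar_def Some_in_Dbar_iff f_def)
  moreover have "aD J t None = None"
    by (simp add: aD_def ext_Dbar_def)
  ultimately show ?thesis
    unfolding similarity_def using pol assms by (intro conjI exI[of _ f] exI[of _ 0]) auto
qed

lemma similarity_mD:
  assumes "(\<phi>, \<psi>) \<in> Mpairs J"
  shows "similarity 1 (mD J \<phi> \<psi>)"
proof -
  have \<phi>: "orthogonal_transformation \<phi>" and \<psi>: "orthogonal_transformation \<psi>"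
    and \<phi>e: "\<phi> e = e" and equiv: "\<And>\<zeta> v. \<psi> (J \<zeta> v) = J (\<phi> \<zeta>) (\<psi> v)"
    using assms by (auto simp: Mpairs_def)
  note lin = orthogonal_transformation_linear[OF \<phi>] orthogonal_transformation_linear[OF \<psi>]
  define f where "f p = (\<phi> (fst p), \<psi> (snd p))" for p :: "'c \<times> 'v"
  have \<phi>_herm: "herm (\<psi> v) (\<psi> u) = \<phi> (herm v u)" for v u
  proof (rule inner_eqI)
    fix \<kappa>
    obtain \<kappa>' where "\<kappa> = \<phi> \<kappa>'"
      using orthogonal_transformation_surj[OF \<phi>] by blast
    then show "herm (\<psi> v) (\<psi> u) \<bullet> \<kappa> = \<phi> (herm v u) \<bullet> \<kappa>"
      using \<phi> \<psi> by (simp add: herm_inner flip: equiv) (simp add: orthogonal_transformation_def herm_inner)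
  qed
  have \<phi>_cnj: "cnj (\<phi> \<zeta>) = \<phi> (cnj \<zeta>)" for \<zeta>
  proof -
    have "\<phi> \<zeta> \<bullet> e = \<zeta> \<bullet> e"
      using \<phi> \<phi>e unfolding orthogonal_transformation_def by metis
    then show ?thesis
      by (simp add: conjC_eq linear_diff[OF lin(1)] linear_cmul[OF lin(1)] \<phi>e)
  qed
  have pol: "pol (f p) (f p') = \<phi> (pol p p')" for p p'
    by (simp add: pol_def f_def \<phi>_herm \<phi>_cnj linear_diff[OF lin(1)] linear_add[OF lin(1)]
        linear_cmul[OF lin(1)])
  have "htD (f p) = 1 * htD p" for p
    by (rule htD_scaled, unfold pol, unfold pol_self) (simp add: linear_cmul[OF lin(1)] \<phi>e)
  moreover have "f 0 = 0"
    by (simp add: f_def zero_prod_def linear_0[OF lin(1)] linear_0[OF lin(2)])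
  moreover have "mD J \<phi> \<psi> (Some p) = Some (f p)" if "0 \<le> htD p" for p
    using that by (cases p) (simp add: mD_def ext_Dbar_def Some_in_Dbar_iff f_def)
  moreover have "mD J \<phi> \<psi> None = None"
    by (simp add: mD_def ext_Dbar_def)
  moreover have "norm (pol (f p) (f p')) = 1 * norm (pol p p')" for p p'
    using pol \<phi> by (simp add: orthogonal_transformation)
  ultimately show ?thesis
    unfolding similarity_def by (intro conjI exI[of _ f] exI[of _ 0]) auto
qed

lemma htD_zero [simp]: "htD 0 = 0"
  by (simp add: htD_def reC_def)

text \<open>Since the left factor fixes \<open>0\<close>, the composite sends to \<open>0\<close> what the right factor does.\<close>

lemma similarity_fixes_zero_comp:
  assumes "similarity k h" "similarity k' h'" "k > 0" "k' > 0" "h (Some 0) = Some 0"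
  shows "similarity (k * k') (h \<circ> h')"
proof -
  obtain f where f: "\<And>p. 0 \<le> htD p \<Longrightarrow> h (Some p) = Some (f p)" "\<And>p. htD (f p) = k * htD p"
    "\<And>p p'. norm (pol (f p) (f p')) = k * norm (pol p p')" and "h None = None"
    using assms(1) unfolding similarity_def by blast
  obtain f' c where f': "\<And>p. 0 \<le> htD p \<Longrightarrow> h' (Some p) = Some (f' p)" "\<And>p. htD (f' p) = k' * htD p"
    "\<And>p p'. norm (pol (f' p) (f' p')) = k' * norm (pol p p')" "h' None = None" "f' c = 0"
    using assms(2) unfolding similarity_def by blast
  have "f 0 = 0"
    using f(1)[of 0] assms(5) by simp
  then show ?thesis
    unfolding similarity_def
    by (intro conjI exI[of _ "f \<circ> f'"] exI[of _ c]) (use f f' assms \<open>h None = None\<close> in auto)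
qed

lemma aD_zero: "aD J t (Some 0) = Some 0"
  by (simp add: aD_def ext_Dbar_def Some_in_Dbar_iff) (simp add: zero_prod_def)

lemma mD_zero:
  assumes "(\<phi>, \<psi>) \<in> Mpairs J"
  shows "mD J \<phi> \<psi> (Some 0) = Some 0"
proof -
  have "\<phi> 0 = 0" "\<psi> 0 = 0"
    using assms by (auto simp: Mpairs_def intro!: linear_0 orthogonal_transformation_linear)
  then show ?thesis
    by (simp add: mD_def ext_Dbar_def Some_in_Dbar_iff) (simp add: zero_prod_def)
qed

lemma similarity_MAN:
  assumes "m \<in> Mgrp J" "t > 0" "n \<in> Ngrp J"
  shows "similarity t (m \<circ> aD J t \<circ> n)"
proof -
  obtain Z X where n: "n = nD J Z X" "Z \<in> Cprime J"
    using assms(3) unfolding Ngrp_def by blast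
  obtain \<phi> \<psi> where m: "m = mD J \<phi> \<psi>" "(\<phi>, \<psi>) \<in> Mpairs J"
    using assms(1) unfolding Mgrp_def by blast
  have "similarity (1 * (t * 1)) (m \<circ> (aD J t \<circ> n))"
    using assms(2) n m
    by (intro similarity_fixes_zero_comp)
      (auto intro: similarity_aD similarity_mD similarity_nD aD_zero mD_zero)
  then show ?thesis
    by (simp add: comp_assoc)
qed

subsection \<open>The inversion \<open>\<sigma>\<close>\<close>

lemma norm_invC: "norm (invC J \<zeta>) = 1 / norm \<zeta>"
  by (simp add: invC_def power2_eq_square)

lemma prodC_invC:
  assumes "\<zeta> \<noteq> 0"
  shows "prodC (invC J \<zeta>) \<zeta> = e" "prodC \<zeta> (invC J \<zeta>) = e"
  using assms by (simp_all add: invC_def prodC_simps prodC_cnj)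

definition inversion :: "'c \<times> 'v \<Rightarrow> 'c \<times> 'v" where
  "inversion p = (invC J (fst p), - J (invC J (fst p)) (snd p))"

text \<open>In associative notation the left-hand side is
  \<open>\<zeta>\<^sup>-\<^sup>1 + cnj \<omega>\<^sup>-\<^sup>1 - 1/2 \<zeta>\<^sup>-\<^sup>1 \<beta>\<^sub>2(v, u) cnj \<omega>\<^sup>-\<^sup>1\<close>, from which \<open>\<zeta>\<^sup>-\<^sup>1\<close> and \<open>cnj \<omega>\<^sup>-\<^sup>1\<close> can be factored
  out on the two sides.\<close>

lemma pol_inversion:
  assumes "fst p \<noteq> 0" "fst p' \<noteq> 0"
  shows "pol (inversion p) (inversion p')
    = prodC (invC J (fst p)) (prodC (pol p p') (cnj (invC J (fst p'))))"
proof -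
  have 1: "prodC (invC J (fst p)) (prodC (fst p) (cnj (invC J (fst p')))) = cnj (invC J (fst p'))"
    using prodC_invC[OF assms(1)] by (simp flip: prodC_assoc)
  have "prodC (cnj (fst p')) (cnj (invC J (fst p'))) = e"
    using prodC_invC[OF assms(2)] by (simp flip: cnj_prodC)
  then have 2: "prodC (invC J (fst p)) (prodC (cnj (fst p')) (cnj (invC J (fst p')))) = invC J (fst p)"
    by simp
  show ?thesis
    by (simp add: pol_def inversion_def herm_simps herm_J prodC_simps 1 2)
qed

lemma norm_pol_inversion:
  assumes "fst p \<noteq> 0" "fst p' \<noteq> 0"
  shows "norm (pol (inversion p) (inversion p')) = norm (pol p p') / (norm (fst p) * norm (fst p'))"
  by (simp add: pol_inversion assms norm_prodC norm_invC)

lemma htD_inversion: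
  assumes "fst p \<noteq> 0"
  shows "htD (inversion p) = htD p / (norm (fst p))\<^sup>2"
proof -
  have "pol (inversion p) (inversion p) = (2 * htD p) *\<^sub>R prodC (invC J (fst p)) (cnj (invC J (fst p)))"
    unfolding pol_inversion[OF assms assms] pol_self[of p] by (simp add: prodC_simps)
  also have "\<dots> = (1 / (norm (fst p))\<^sup>2) *\<^sub>R pol p p"
    by (simp add: prodC_cnj norm_invC pol_self power_divide)
  finally show ?thesis
    using htD_scaled by fastforce
qed

lemma sigmaD_Some:
  assumes "0 < htD p"
  shows "fst p \<noteq> 0" "sigmaD J (Some p) = Some (inversion p)"
proof -
  show "fst p \<noteq> 0"
    using assms pol_nonzero[of p 0] by (simp add: pol_zero)
  then show "sigmaD J (Some p) = Some (inversion p)"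
    using assms by (cases p) (simp add: sigmaD_def Some_in_Dbar_iff inversion_def)
qed

lemma sigmaD_zero: "sigmaD J (Some 0) = None"
  by (simp add: sigmaD_def Some_in_Dbar_iff) (simp add: zero_prod_def)

subsection \<open>Elements of the group\<close>

text \<open>The quotient plays the part of a distance: for two points on a vertical line at
  distance \<open>d\<close> it is \<open>4 cosh\<^sup>2 (d/2)\<close>.\<close>

definition preserves_ratio :: "(('c \<times> 'v) option \<Rightarrow> ('c \<times> 'v) option) \<Rightarrow> bool" where
  "preserves_ratio g \<longleftrightarrow>
     (\<forall>p\<in>Ddom J. \<exists>q\<in>Ddom J. g (Some p) = Some q) \<and>
     (\<forall>p\<in>Ddom J. \<forall>p'\<in>Ddom J. \<forall>q q'. g (Some p) = Some q \<longrightarrow> g (Some p') = Some q' \<longrightarrow>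
        (norm (pol q q'))\<^sup>2 / (htD q * htD q') = (norm (pol p p'))\<^sup>2 / (htD p * htD p'))"

lemma preserves_ratioD:
  assumes "preserves_ratio g" "p \<in> Ddom J" "p' \<in> Ddom J" "g (Some p) = Some q" "g (Some p') = Some q'"
  shows "(norm (pol q q'))\<^sup>2 / (htD q * htD q') = (norm (pol p p'))\<^sup>2 / (htD p * htD p')"
  using assms unfolding preserves_ratio_def by blast

lemma preserves_ratio_comp:
  assumes g: "preserves_ratio g" and h: "preserves_ratio h"
  shows "preserves_ratio (g \<circ> h)"
  unfolding preserves_ratio_def
proof (intro conjI ballI allI impI)
  fix p assume "p \<in> Ddom J"
  then show "\<exists>q\<in>Ddom J. (g \<circ> h) (Some p) = Some q"
    using g h unfolding preserves_ratio_def by (metis comp_apply)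
next
  fix p p' q q' assume p: "p \<in> Ddom J" "p' \<in> Ddom J"
    and q: "(g \<circ> h) (Some p) = Some q" "(g \<circ> h) (Some p') = Some q'"
  obtain r r' where r: "r \<in> Ddom J" "r' \<in> Ddom J" "h (Some p) = Some r" "h (Some p') = Some r'"
    using h p unfolding preserves_ratio_def by blast
  have "(norm (pol q q'))\<^sup>2 / (htD q * htD q') = (norm (pol r r'))\<^sup>2 / (htD r * htD r')"
    using r q by (intro preserves_ratioD[OF g]) auto
  also have "\<dots> = (norm (pol p p'))\<^sup>2 / (htD p * htD p')"
    using p r by (intro preserves_ratioD[OF h])
  finally show "(norm (pol q q'))\<^sup>2 / (htD q * htD q') = (norm (pol p p'))\<^sup>2 / (htD p * htD p')" .
qed

lemma similarity_preserves_ratio: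
  assumes "similarity k h" "k > 0"
  shows "preserves_ratio h"
proof -
  obtain f where f: "\<And>p. 0 \<le> htD p \<Longrightarrow> h (Some p) = Some (f p)" "\<And>p. htD (f p) = k * htD p"
    "\<And>p p'. norm (pol (f p) (f p')) = k * norm (pol p p')"
    using assms(1) unfolding similarity_def by blast
  show ?thesis
    unfolding preserves_ratio_def using f assms(2)
    by (auto simp: Ddom_iff power_mult_distrib power2_eq_square)
qed

lemma sigmaD_preserves_ratio: "preserves_ratio (sigmaD J)"
  unfolding preserves_ratio_def Ddom_iff
proof (intro conjI ballI allI impI; unfold Ddom_iff)
  fix p assume p: "0 < htD p"
  then show "\<exists>q\<in>Ddom J. sigmaD J (Some p) = Some q"
    using sigmaD_Some[OF p] by (simp add: Ddom_iff htD_inversion)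
next
  fix p p' q q' assume p: "0 < htD p" "0 < htD p'"
    and q: "sigmaD J (Some p) = Some q" "sigmaD J (Some p') = Some q'"
  have "q = inversion p" "q' = inversion p'"
    using q sigmaD_Some(2) p by auto
  then show "(norm (pol q q'))\<^sup>2 / (htD q * htD q') = (norm (pol p p'))\<^sup>2 / (htD p * htD p')"
    using sigmaD_Some(1)[OF p(1)] sigmaD_Some(1)[OF p(2)]
    by (simp add: htD_inversion norm_pol_inversion power_mult_distrib power_divide)
qed

lemma Ngrp_similarity: "n \<in> Ngrp J \<Longrightarrow> similarity 1 n"
  using similarity_nD unfolding Ngrp_def by blast

text \<open>The height is divided by \<open>t|pol p c|\<^sup>2\<close>, where \<open>c\<close> is the preimage of infinity:
  \<open>\<sigma>\<close> divides the height by the squared norm of the first coordinate, and after the similarity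
  that sends \<open>c\<close> to \<open>0\<close> this coordinate is the polarized height against the image of \<open>c\<close>.\<close>

lemma bruhat_height:
  assumes "n1 \<in> Ngrp J" "m \<in> Mgrp J" "t > 0" "n2 \<in> Ngrp J"
    and g: "g = n1 \<circ> sigmaD J \<circ> m \<circ> aD J t \<circ> n2"
  obtains c where "htD c = 0" "g (Some c) = None"
    "\<And>p. 0 < htD p \<Longrightarrow> \<exists>q. g (Some p) = Some q \<and> htD q * (t * (norm (pol p c))\<^sup>2) = htD p"
proof -
  define h where "h = m \<circ> aD J t \<circ> n2"
  have gh: "g = n1 \<circ> sigmaD J \<circ> h"
    by (simp add: g h_def comp_assoc)
  have "similarity t h"
    unfolding h_def by (rule similarity_MAN) (use assms in auto)
  then obtain f c where f: "\<And>p. 0 \<le> htD p \<Longrightarrow> h (Some p) = Some (f p)" "\<And>p. htD (f p) = t * htD p"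
    "\<And>p p'. norm (pol (f p) (f p')) = t * norm (pol p p')" and c: "f c = 0"
    unfolding similarity_def by blast
  obtain f1 where f1: "\<And>p. 0 \<le> htD p \<Longrightarrow> n1 (Some p) = Some (f1 p)" "\<And>p. htD (f1 p) = htD p"
    and "n1 None = None"
    using Ngrp_similarity[OF assms(1)] unfolding similarity_def by auto
  have htc: "htD c = 0"
    using f(2)[of c] c \<open>t > 0\<close> by simp
  show ?thesis
  proof
    show "htD c = 0" by (rule htc)
    show "g (Some c) = None"
      using f(1)[of c] htc c \<open>n1 None = None\<close> by (simp add: gh sigmaD_zero)
    fix p assume p: "0 < htD p"
    have hf: "0 < htD (f p)"
      using p \<open>t > 0\<close> f(2) by simp
    have nz: "fst (f p) \<noteq> 0"
      by (rule sigmaD_Some[OF hf])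
    have nf: "norm (fst (f p)) = t * norm (pol p c)"
      using f(3)[of p c] c by (simp add: pol_zero)
    have hi: "htD (inversion (f p)) = htD (f p) / (norm (fst (f p)))\<^sup>2"
      by (rule htD_inversion[OF nz])
    have "0 < htD (inversion (f p))"
      unfolding hi using hf nz by simp
    then have "g (Some p) = Some (f1 (inversion (f p)))"
      using p f(1)[of p] sigmaD_Some(2)[OF hf] f1(1) by (simp add: gh)
    moreover have "htD (f1 (inversion (f p))) * (t * (norm (pol p c))\<^sup>2) = htD p"
      using nz \<open>t > 0\<close> unfolding f1(2) hi f(2) nf[symmetric]
      by (simp add: nf power2_eq_square) (use nf nz in auto)
    ultimately show "\<exists>q. g (Some p) = Some q \<and> htD q * (t * (norm (pol p c))\<^sup>2) = htD p"
      by blast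
  qed
qed

lemma Mres_subset: "Mres J \<subseteq> Mgrp J"
  unfolding Mres_def Mgrp_def by blast

lemma Gres_cases:
  assumes "g \<in> Gres J"
  obtains (affine) t where "t > 0" "similarity t g"
  | (bruhat) n1 m t n2 where "n1 \<in> Ngrp J" "m \<in> Mgrp J" "t > 0" "n2 \<in> Ngrp J"
      "g = n1 \<circ> sigmaD J \<circ> m \<circ> aD J t \<circ> n2"
  using assms unfolding Gres_def Agrp_def
  using Mres_subset similarity_MAN by blast

lemma Gres_preserves_ratio:
  assumes "g \<in> Gres J"
  shows "preserves_ratio g"
  using assms
proof (cases rule: Gres_cases)
  case (affine t)
  then show ?thesis using similarity_preserves_ratio by blast
next
  case (bruhat n1 m t n2)
  have "g = n1 \<circ> (sigmaD J \<circ> (m \<circ> aD J t \<circ> n2))"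
    by (simp add: bruhat comp_assoc)
  moreover have "preserves_ratio (m \<circ> aD J t \<circ> n2)"
    using similarity_MAN[OF bruhat(2-4)] bruhat(3) by (rule similarity_preserves_ratio)
  moreover have "preserves_ratio n1"
    using Ngrp_similarity[OF bruhat(1)] by (rule similarity_preserves_ratio) simp
  ultimately show ?thesis
    using preserves_ratio_comp sigmaD_preserves_ratio by presburger
qed

end

section \<open>Inverses of isometries\<close>

lemma frechet_derivative_transform_open:
  assumes "open U" "x \<in> U" "\<And>y. y \<in> U \<Longrightarrow> f y = g y" "f differentiable (at x)"
  shows "g differentiable (at x)" "frechet_derivative g (at x) = frechet_derivative f (at x)"
proof -
  have "(f has_derivative frechet_derivative f (at x)) (at x)"
    using assms(4) frechet_derivative_works by blast
  then have "(g has_derivative frechet_derivative f (at x)) (at x)"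
    by (rule has_derivative_transform_within_open) (use assms in auto)
  then show "g differentiable (at x)" "frechet_derivative g (at x) = frechet_derivative f (at x)"
    by (rule differentiableI, rule frechet_derivative_at[symmetric])
qed

lemma Ck_on_cong_open:
  assumes "open U" "\<And>y. y \<in> U \<Longrightarrow> f y = g y" "Ck_on k f U"
  shows "Ck_on k g U"
  using assms(2,3)
proof (induction k arbitrary: f g)
  case 0
  then show ?case by (simp cong: continuous_on_cong)
next
  case (Suc k)
  have "g differentiable (at x)" and deriv: "frechet_derivative g (at x) = frechet_derivative f (at x)"
    if x: "x \<in> U" for x
  proof -
    have "f differentiable (at x)"
      using Suc.prems(2) x by simp
    note transform = frechet_derivative_transform_open[OF assms(1) x Suc.prems(1) this]
    show "g differentiable (at x)" "frechet_derivative g (at x) = frechet_derivative f (at x)"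
      by (rule transform, assumption)+
  qed
  moreover have "Ck_on k (\<lambda>x. frechet_derivative g (at x) w) U" for w
  proof (rule Suc.IH)
    show "frechet_derivative f (at x) w = frechet_derivative g (at x) w" if "x \<in> U" for x
      by (simp only: deriv[OF that])
    show "Ck_on k (\<lambda>x. frechet_derivative f (at x) w) U"
      using Suc.prems(2) by simp
  qed
  ultimately show ?case
    by simp
qed

lemma smooth_on_differentiable:
  assumes "smooth_on f U" "x \<in> U"
  shows "f differentiable (at x)"
proof -
  have "Ck_on (Suc 0) f U"
    using assms(1) unfolding smooth_on_def by blast
  then show ?thesis
    using assms(2) by simp
qed

context
  fixes J :: "'c::euclidean_space \<Rightarrow> 'v::euclidean_space \<Rightarrow> 'v"
begin

lemma open_Ddom: "open (Ddom J)"
proof -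
  have "Ddom J = {p. 1/4 * (norm (snd p))\<^sup>2 < fst p \<bullet> unitC J}"
    by (auto simp: Ddom_def reC_def)
  then show ?thesis
    by (auto intro!: open_Collect_less continuous_intros)
qed

text \<open>The chain rule makes the differential of the inverse a right inverse of the differential of
  \<open>f\<close>, so the invariance of the metric under \<open>f\<close> can be read backwards.\<close>

lemma isometry_D_inv_into:
  assumes "isometry_D J f"
  shows "isometry_D J (inv_into (Ddom J) f)"
proof -
  define D where "D = Ddom J"
  define F where "F = inv_into D f"
  have bij: "bij_betw f D D" and sf: "smooth_on f D" and sF: "smooth_on F D"
    and iso: "\<And>p \<xi> \<eta>. p \<in> D \<Longrightarrow>
        metricD J (f p) (frechet_derivative f (at p) \<xi>) (frechet_derivative f (at p) \<eta>)
          = metricD J p \<xi> \<eta>"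
    using assms unfolding isometry_D_def D_def F_def by auto
  have opn: "open D"
    unfolding D_def by (rule open_Ddom)
  have bijF: "bij_betw F D D"
    unfolding F_def by (rule bij_betw_inv_into[OF bij])
  have Ff: "F (f p) = p" if "p \<in> D" for p
    unfolding F_def using bij_betw_inv_into_left[OF bij that] .
  have fF: "f (F p) = p" if "p \<in> D" for p
    unfolding F_def using bij_betw_inv_into_right[OF bij that] .
  have FD: "F p \<in> D" if "p \<in> D" for p
    using bijF that by (rule bij_betwE[THEN bspec])
  have "inv_into D F p = f p" if "p \<in> D" for p
    unfolding F_def by (rule inv_into_inv_into_eq[OF bij that])
  then have "smooth_on (inv_into D F) D"
    using sf Ck_on_cong_open[OF opn, of f "inv_into D F"] unfolding smooth_on_def by simp
  moreover have "metricD J (F p) (frechet_derivative F (at p) \<xi>) (frechet_derivative F (at p) \<eta>)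
      = metricD J p \<xi> \<eta>" if p: "p \<in> D" for p \<xi> \<eta>
  proof -
    let ?L = "frechet_derivative f (at (F p))" and ?M = "frechet_derivative F (at p)"
    have "((f \<circ> F) has_derivative ?L \<circ> ?M) (at p)"
      using smooth_on_differentiable[OF sf FD[OF p]] smooth_on_differentiable[OF sF p]
      by (intro diff_chain_at) (auto simp: frechet_derivative_works)
    then have "((\<lambda>x. x) has_derivative ?L \<circ> ?M) (at p)"
      by (rule has_derivative_transform_within_open[OF _ opn p]) (simp add: fF)
    then have "?L \<circ> ?M = (\<lambda>x. x)"
      using has_derivative_unique has_derivative_ident by blast
    then have "?L (?M \<xi>) = \<xi>" for \<xi>
      by (metis comp_apply)
    then show ?thesis
      using iso[OF FD[OF p], of "?M \<xi>" "?M \<eta>"] by (simp add: fF p)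
  qed
  ultimately show ?thesis
    using bijF sF unfolding isometry_D_def D_def[symmetric] F_def[symmetric] by blast
qed

lemma Ggrp_carrier_inverse:
  assumes "g \<in> carrier (Ggrp J)"
  shows "inv_into UNIV g \<in> carrier (Ggrp J)"
proof -
  obtain f where perm: "g permutes Dbar J" and hom: "homeomorphic_map (Dbar_top J) (Dbar_top J) g"
    and f: "isometry_D J f" and gf: "\<And>p. p \<in> Ddom J \<Longrightarrow> g (Some p) = Some (f p)"
    using assms unfolding Ggrp_def by auto
  let ?g' = "inv_into UNIV g"
  have perm': "?g' permutes Dbar J"
    by (rule permutes_inv[OF perm])
  obtain k where k: "homeomorphic_maps (Dbar_top J) (Dbar_top J) g k"
    using hom homeomorphic_map_maps by blast
  then have "homeomorphic_map (Dbar_top J) (Dbar_top J) k"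
    using homeomorphic_maps_map by blast
  moreover have "k x = ?g' x" if "x \<in> topspace (Dbar_top J)" for x
  proof -
    have "g (k x) = x"
      using k that unfolding homeomorphic_maps_def by blast
    then show ?thesis
      using permutes_inv_eq[OF perm, of x "k x"] by simp
  qed
  ultimately have hom': "homeomorphic_map (Dbar_top J) (Dbar_top J) ?g'"
    by (rule homeomorphic_map_eq)
  have "?g' (Some p) = Some (inv_into (Ddom J) f p)" if "p \<in> Ddom J" for p
  proof -
    have bij: "bij_betw f (Ddom J) (Ddom J)"
      using f unfolding isometry_D_def by blast
    have "inv_into (Ddom J) f p \<in> Ddom J" "f (inv_into (Ddom J) f p) = p"
      using bij_betw_apply[OF bij_betw_inv_into[OF bij] that] bij_betw_inv_into_right[OF bij that] .
    then show ?thesis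
      using gf permutes_inv_eq[OF perm, of "Some p" "Some (inv_into (Ddom J) f p)"] by simp
  qed
  then show ?thesis
    using perm' hom' isometry_D_inv_into[OF f] unfolding Ggrp_def by auto
qed

text \<open>The inverse in the record \<open>Ggrp J\<close> is a definite description over the carrier. It is the
  inverse map because the latter is again a homeomorphism extending an isometry.\<close>

lemma m_inv_Ggrp:
  assumes "g \<in> carrier (Ggrp J)"
  shows "m_inv (Ggrp J) g = inv_into UNIV g"
proof -
  have bij: "bij g"
    using assms permutes_bij unfolding Ggrp_def by auto
  have "inv_into UNIV g \<in> carrier (Ggrp J)"
    by (rule Ggrp_carrier_inverse[OF assms])
  moreover have "g \<circ> inv_into UNIV g = id" "inv_into UNIV g \<circ> g = id"
    using bij_is_surj[OF bij] bij_is_inj[OF bij] by (simp_all add: surj_iff inj_iff)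
  ultimately show ?thesis
    unfolding m_inv_def
    by (intro the_equality) (auto simp: Ggrp_def intro: inv_unique_comp[symmetric])
qed

end

section \<open>Heights and isometric spheres in \<open>H\<close>\<close>

text \<open>\<open>betaHD\<close> on finite points.\<close>

definition toD :: "'c::euclidean_space \<times> 'v::euclidean_space \<Rightarrow> 'c \<times> 'v" where
  "toD z = (fst z, sqrt 2 *\<^sub>R snd z)"

lemma betaHD_Some: "betaHD (Some z) = Some (toD z)"
  by (simp add: betaHD_def toD_def case_prod_beta)

lemma betaHD_None: "betaHD None = None"
  by (simp add: betaHD_def)

lemma toD_surj: "toD (fst p, (1 / sqrt 2) *\<^sub>R snd p) = p"
  by (simp add: toD_def)

lemma toD_inject: "toD z = toD w \<longleftrightarrow> z = w"
  by (auto simp: toD_def prod_eq_iff)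

lemma betaHD_inject: "betaHD x = betaHD y \<longleftrightarrow> x = y"
  by (cases x; cases y) (auto simp: betaHD_Some betaHD_None toD_inject)

lemma inv_betaHD: "inv_into UNIV betaHD (betaHD x) = x"
  by (rule inv_f_f) (simp add: inj_def betaHD_inject)

lemma actHbar_eqI: "g (betaHD x) = betaHD y \<Longrightarrow> actHbar g x = y"
  by (simp add: actHbar_def inv_betaHD)

context associative_J2C
begin

definition polH :: "'c \<times> 'v \<Rightarrow> 'c \<times> 'v \<Rightarrow> 'c" where
  "polH z w = fst z + cnj (fst w) - herm (snd z) (snd w)"

lemma polH_eq: "polH z w = pol (toD z) (toD w)"
  by (simp add: polH_def pol_def toD_def herm_simps)

lemma htH_eq: "htH J z = reC J (fst z) - 1/2 * (norm (snd z))\<^sup>2"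
  by (simp add: htH_def case_prod_beta)

lemma htD_toD: "htD (toD z) = htH J z"
  by (simp add: htH_eq htD_def toD_def power_mult_distrib)

lemma Hdom_iff: "z \<in> Hdom J \<longleftrightarrow> 0 < htH J z"
  by (cases z) (simp add: Hdom_def htH_def)

lemma toD_Ddom_iff: "toD z \<in> Ddom J \<longleftrightarrow> z \<in> Hdom J"
  by (simp add: Ddom_iff Hdom_iff htD_toD)

lemma reC_polH: "reC J (polH z w) = htH J z + htH J w + 1/2 * (norm (snd z - snd w))\<^sup>2"
proof -
  have "snd (toD z) - snd (toD w) = sqrt 2 *\<^sub>R (snd z - snd w)"
    by (simp add: toD_def scaleR_right_diff_distrib)
  then show ?thesis
    by (simp add: polH_eq reC_pol htD_toD power_mult_distrib)
qed

text \<open>At a boundary point the absolute value in the Cygan metric disappears.\<close>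

lemma cygan_boundary:
  assumes "htH J c = 0" "0 < htH J z"
  shows "cygan J z c = sqrt (norm (polH z c))"
proof -
  have "1/2 * (norm (snd z))\<^sup>2 + 1/2 * (norm (snd c))\<^sup>2 + \<bar>htH J z - htH J c\<bar>
      = reC J (fst z) + reC J (fst c)"
    using assms by (simp add: htH_eq)
  then have "cygan J z c = sqrt (norm ((reC J (fst z) + reC J (fst c)) *\<^sub>R e
      + imC J (fst z) - imC J (fst c) - herm (snd z) (snd c)))"
    unfolding cygan_def case_prod_beta by simp
  also have "(reC J (fst z) + reC J (fst c)) *\<^sub>R e + imC J (fst z) - imC J (fst c)
      - herm (snd z) (snd c) = polH z c"
    unfolding polH_def conjC_def imC_def by (simp add: scaleR_add_left algebra_simps)
  finally show ?thesis .
qed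

lemma continuous_on_reC [continuous_intros]:
  "continuous_on S f \<Longrightarrow> continuous_on S (\<lambda>x. reC J (f x))"
  unfolding reC_def by (intro continuous_intros)

lemma continuous_on_htH [continuous_intros]:
  "continuous_on S f \<Longrightarrow> continuous_on S (\<lambda>x. htH J (f x))"
  unfolding htH_eq by (intro continuous_intros)

lemma continuous_on_polH:
  "continuous_on S (\<lambda>z. polH z w)"
proof -
  have "bounded_bilinear herm"
    using bilinear_herm bilinear_conv_bounded_bilinear by blast
  note bounded_bilinear.continuous_on[OF this, continuous_intros]
  show ?thesis
    unfolding polH_def by (intro continuous_intros)
qed

lemma open_Hdom: "open (Hdom J)"
proof -
  have "Hdom J = {z. 0 < htH J z}"
    by (auto simp: Hdom_iff)
  then show ?thesis
    by (auto intro!: open_Collect_less continuous_intros)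
qed

text \<open>\<open>H\<close> lies above a paraboloid; the height of a convex combination exceeds that of the
  combination of heights by a multiple of \<open>|v - v'|\<^sup>2\<close>.\<close>

lemma convex_Hdom: "convex (Hdom J)"
proof (rule convexI)
  fix z w and a b :: real
  assume zw: "z \<in> Hdom J" "w \<in> Hdom J" and ab: "0 \<le> a" "0 \<le> b" "a + b = 1"
  have "(norm (a *\<^sub>R x + b *\<^sub>R y))\<^sup>2 + a * b * (norm (x - y))\<^sup>2
      = (a + b) * (a * (norm x)\<^sup>2 + b * (norm y)\<^sup>2)" for x y :: 'v
    unfolding power2_norm_eq_inner
    by (simp add: inner_add_left inner_add_right inner_diff_left inner_diff_right inner_commute
        algebra_simps)
  from this[of "snd z" "snd w"]
  have "htH J (a *\<^sub>R z + b *\<^sub>R w)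
      = a * htH J z + b * htH J w + 1/2 * (a * b * (norm (snd z - snd w))\<^sup>2)"
    unfolding ab(3) by (simp add: htH_eq reC_simps algebra_simps)
  moreover have "0 < a * htH J z + b * htH J w"
  proof (cases "a = 0")
    case True
    then show ?thesis using zw ab by (simp add: Hdom_iff)
  next
    case False
    then have "0 < a * htH J z" "0 \<le> b * htH J w"
      using zw ab by (auto simp: Hdom_iff)
    then show ?thesis by simp
  qed
  moreover have "0 \<le> 1/2 * (a * b * (norm (snd z - snd w))\<^sup>2)"
    using ab by simp
  ultimately show "a *\<^sub>R z + b *\<^sub>R w \<in> Hdom J"
    unfolding Hdom_iff by linarith
qed

subsection \<open>Vertical translations\<close>

definition lift :: "real \<Rightarrow> 'c \<times> 'v \<Rightarrow> 'c \<times> 'v" where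
  "lift s z = z + (s *\<^sub>R e, 0)"

lemma htH_lift: "htH J (lift s z) = htH J z + s"
  by (simp add: htH_eq lift_def reC_simps)

lemma polH_lift: "polH (lift s z) c = polH z c + s *\<^sub>R e"
  by (simp add: polH_def lift_def)

lemma lift_lift: "lift s (lift r z) = lift (r + s) z"
  by (simp add: lift_def scaleR_add_left)

lemma lift_0: "lift 0 z = z"
  by (simp add: lift_def flip: zero_prod_def)

lemma dist_lift: "dist (lift s z) z = \<bar>s\<bar>"
  by (simp add: lift_def dist_norm norm_Pair)

lemma norm_polH_lift:
  "(norm (polH (lift s z) c))\<^sup>2 = (norm (polH z c))\<^sup>2 + 2 * s * reC J (polH z c) + s\<^sup>2"
  unfolding polH_lift power2_norm_eq_inner reC_def
  by (simp add: inner_add_left inner_add_right inner_commute algebra_simps power2_eq_square)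

subsection \<open>The action of a group element\<close>

lemma actHbar_Some:
  assumes "preserves_ratio g" "z \<in> Hdom J"
  shows "actH g z \<in> Hdom J" "actHbar g (Some z) = Some (actH g z)"
    "g (Some (toD z)) = Some (toD (actH g z))"
proof -
  obtain p where p: "p \<in> Ddom J" "g (Some (toD z)) = Some p"
    using assms toD_Ddom_iff unfolding preserves_ratio_def by blast
  define w where "w = (fst p, (1 / sqrt 2) *\<^sub>R snd p)"
  have w: "toD w = p"
    unfolding w_def by (rule toD_surj)
  have "actHbar g (Some z) = Some w"
    by (rule actHbar_eqI) (simp add: betaHD_Some p w)
  then show "actH g z \<in> Hdom J" "actHbar g (Some z) = Some (actH g z)"
    "g (Some (toD z)) = Some (toD (actH g z))"
    using p w toD_Ddom_iff[of w] by (simp_all add: actH_def)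
qed

lemma actH_ratio:
  assumes "preserves_ratio g" "z \<in> Hdom J" "w \<in> Hdom J"
  shows "(norm (polH (actH g z) (actH g w)))\<^sup>2 / (htH J (actH g z) * htH J (actH g w))
    = (norm (polH z w))\<^sup>2 / (htH J z * htH J w)"
  using preserves_ratioD[OF assms(1) _ _ actHbar_Some(3)[OF assms(1,2)] actHbar_Some(3)[OF assms(1,3)]] assms
  by (simp add: toD_Ddom_iff polH_eq htD_toD)

end

section \<open>Discontinuous groups with trivial stabilizer of infinity\<close>

locale discontinuous_group = associative_J2C J
  for J :: "'c::euclidean_space \<Rightarrow> 'v::euclidean_space \<Rightarrow> 'v" +
  fixes \<Gamma> :: "(('c \<times> 'v) option \<Rightarrow> ('c \<times> 'v) option) set"
  assumes subgrp: "subgroup \<Gamma> (Ggrp J)"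
    and discont: "properly_discontinuous J \<Gamma>"
    and Gres: "\<Gamma> \<subseteq> Gres J"
    and stab: "stab_inf \<Gamma> = {id}"
    and Omega: "None \<in> Omega J \<Gamma>"
begin

lemma preserves_ratio_mem: "g \<in> \<Gamma> \<Longrightarrow> preserves_ratio g"
  using Gres Gres_preserves_ratio by blast

lemma in_carrier: "g \<in> \<Gamma> \<Longrightarrow> g \<in> carrier (Ggrp J)"
  using subgroup.subset[OF subgrp] by blast

lemma bij_mem: "g \<in> \<Gamma> \<Longrightarrow> bij g"
  using in_carrier permutes_bij unfolding Ggrp_def by auto

lemma id_mem: "id \<in> \<Gamma>"
  using subgroup.one_closed[OF subgrp] by (simp add: Ggrp_def)

lemma comp_mem: "g \<in> \<Gamma> \<Longrightarrow> h \<in> \<Gamma> \<Longrightarrow> g \<circ> h \<in> \<Gamma>"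
  using subgroup.m_closed[OF subgrp] by (simp add: Ggrp_def)

lemma inv_mem: "g \<in> \<Gamma> \<Longrightarrow> inv_into UNIV g \<in> \<Gamma>"
  using subgroup.m_inv_closed[OF subgrp] m_inv_Ggrp[OF in_carrier] by simp

lemma inv_comp: "g \<in> \<Gamma> \<Longrightarrow> inv_into UNIV g \<circ> g = id"
  using bij_is_inj[OF bij_mem] by (simp add: inj_iff)

lemma actH_mem: "g \<in> \<Gamma> \<Longrightarrow> z \<in> Hdom J \<Longrightarrow> actH g z \<in> Hdom J"
  by (rule actHbar_Some(1)[OF preserves_ratio_mem])

lemma actH_comp:
  assumes "g \<in> \<Gamma>" "h \<in> \<Gamma>" "z \<in> Hdom J"
  shows "actH (g \<circ> h) z = actH g (actH h z)"
proof -
  have "(g \<circ> h) (Some (toD z)) = Some (toD (actH g (actH h z)))"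
    using assms by (simp add: actHbar_Some(3) preserves_ratio_mem actH_mem)
  moreover have "(g \<circ> h) (Some (toD z)) = Some (toD (actH (g \<circ> h) z))"
    by (rule actHbar_Some(3)[OF preserves_ratio_mem[OF comp_mem]]) (use assms in auto)
  ultimately show ?thesis
    by (simp add: toD_inject)
qed

lemma actH_id: "z \<in> Hdom J \<Longrightarrow> actH id z = z"
  using actHbar_Some(3)[OF preserves_ratio_mem[OF id_mem], of z] by (simp add: toD_inject)

lemma actH_inv: "g \<in> \<Gamma> \<Longrightarrow> z \<in> Hdom J \<Longrightarrow> actH (inv_into UNIV g) (actH g z) = z"
  using actH_comp[OF inv_mem] inv_comp actH_id by metis

subsection \<open>Isometric spheres compare heights\<close>

text \<open>An element that moves infinity lies in the cell \<open>N\<sigma>MAN\<close>. The radius is defined by a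
  description over all its decompositions, so it has to be shown that they agree on \<open>t\<close>: they agree on
  the centre, because \<open>g\<close> is injective, and on the factor \<open>t |pol p c|\<^sup>2\<close> by which \<open>g\<close> lowers any
  single point \<open>p\<close>.\<close>

lemma sphere_parameters:
  assumes g: "g \<in> \<Gamma>" "g \<noteq> id"
  obtains t c where "t > 0" "htH J c = 0" "centre g = c" "radius J g = t powr (- 1/4)"
    "\<And>z. z \<in> Hdom J \<Longrightarrow> htH J (actH g z) * (t * (norm (polH z c))\<^sup>2) = htH J z"
proof -
  have nstab: "g None \<noteq> None"
  proof
    assume "g None = None"
    then have "g \<in> stab_inf \<Gamma>"
      using g by (simp add: stab_inf_def)
    then show False
      using g stab by simp
  qed
  have "g \<in> Gres J" using g Gres by blast
  then obtain n1 m t n2 where n: "n1 \<in> Ngrp J" "m \<in> Mgrp J" "t > 0" "n2 \<in> Ngrp J"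
      and gd: "g = n1 \<circ> sigmaD J \<circ> m \<circ> aD J t \<circ> n2"
    using nstab by (cases rule: Gres_cases) (auto simp: similarity_def)
  obtain c where c: "htD c = 0" "g (Some c) = None"
    "\<And>p. 0 < htD p \<Longrightarrow> \<exists>q. g (Some p) = Some q \<and> htD q * (t * (norm (pol p c))\<^sup>2) = htD p"
    using bruhat_height[OF n gd] by metis
  define w where "w = (fst c, (1 / sqrt 2) *\<^sub>R snd c)"
  have w: "toD w = c"
    unfolding w_def by (rule toD_surj)
  have "inv_into UNIV g None = Some c"
    using inv_f_eq[OF bij_is_inj[OF bij_mem[OF g(1)]] c(2)] .
  then have "actHbar (inv_into UNIV g) None = Some w"
    by (intro actHbar_eqI) (simp add: betaHD_None betaHD_Some w)
  then have centre: "centre g = w"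
    by (simp add: centre_def)
  have uniq: "t' = t" if n': "n1' \<in> Ngrp J" "m' \<in> Mgrp J" "t' > 0" "n2' \<in> Ngrp J"
      "g = n1' \<circ> sigmaD J \<circ> m' \<circ> aD J t' \<circ> n2'" for n1' m' t' n2'
  proof -
    obtain c' where c': "htD c' = 0" "g (Some c') = None"
      "\<And>p. 0 < htD p \<Longrightarrow> \<exists>q. g (Some p) = Some q \<and> htD q * (t' * (norm (pol p c'))\<^sup>2) = htD p"
      using bruhat_height[OF n'] by metis
    have "c' = c"
      using bij_is_inj[OF bij_mem[OF g(1)]] c(2) c'(2) by (metis injD option.inject)
    define p :: "'c \<times> 'v" where "p = (e, 0)"
    have p: "0 < htD p"
      by (simp add: p_def htD_def reC_simps)
    obtain q where q: "g (Some p) = Some q" "htD q * (t * (norm (pol p c))\<^sup>2) = htD p"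
      using c(3)[OF p] by blast
    have "htD q * (t' * (norm (pol p c))\<^sup>2) = htD p"
      using c'(3)[OF p] q(1) \<open>c' = c\<close> by simp
    then have "htD q * (t' * (norm (pol p c))\<^sup>2) = htD q * (t * (norm (pol p c))\<^sup>2)"
      using q(2) by simp
    moreover have "htD q \<noteq> 0" "norm (pol p c) \<noteq> 0"
      using q(2) p by auto
    ultimately show ?thesis
      by simp
  qed
  have rad: "radius J g = t powr (- 1/4)"
    unfolding radius_def
  proof (rule the_equality)
    show "\<exists>n1\<in>Ngrp J. \<exists>m\<in>Mgrp J. \<exists>s>0. \<exists>n2\<in>Ngrp J.
        g = n1 \<circ> sigmaD J \<circ> m \<circ> aD J s \<circ> n2 \<and> t powr (- 1/4) = s powr (- 1/4)"
      using n gd by blast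
  qed (use uniq in blast)
  show ?thesis
  proof
    show "t > 0" "centre g = w" "radius J g = t powr (- 1/4)" by fact+
    show "htH J w = 0"
      using c(1) by (simp add: w flip: htD_toD)
    fix z assume z: "z \<in> Hdom J"
    then have "0 < htD (toD z)"
      by (simp add: htD_toD Hdom_iff)
    then show "htH J (actH g z) * (t * (norm (polH z w))\<^sup>2) = htH J z"
      using c(3)[of "toD z"] actHbar_Some(3)[OF preserves_ratio_mem[OF g(1)] z]
      by (simp add: polH_eq w htD_toD)
  qed
qed

text \<open>Fourth powers turn the comparison of the Cygan distance with the radius into that of
  \<open>|polH z c|\<^sup>2\<close> with \<open>1/t\<close>, which is the comparison of the height of \<open>z\<close> with that of its image.\<close>

lemma sphere_condition:
  assumes g: "g \<in> \<Gamma>" "g \<noteq> id"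
  obtains t c where "t > 0" "htH J c = 0"
    "\<And>z. z \<in> Hdom J \<Longrightarrow> z \<in> ext_sphere J g \<longleftrightarrow> 1 < t * (norm (polH z c))\<^sup>2"
    "\<And>z. z \<in> Hdom J \<Longrightarrow> z \<in> int_sphere J g \<longleftrightarrow> t * (norm (polH z c))\<^sup>2 < 1"
    "\<And>z. z \<in> Hdom J \<Longrightarrow> htH J (actH g z) < htH J z \<longleftrightarrow> 1 < t * (norm (polH z c))\<^sup>2"
    "\<And>z. z \<in> Hdom J \<Longrightarrow> htH J z < htH J (actH g z) \<longleftrightarrow> t * (norm (polH z c))\<^sup>2 < 1"
proof -
  obtain t c where t: "t > 0" and c: "htH J c = 0" "centre g = c" and r: "radius J g = t powr (- 1/4)"
    and height: "\<And>z. z \<in> Hdom J \<Longrightarrow> htH J (actH g z) * (t * (norm (polH z c))\<^sup>2) = htH J z"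
    by (rule sphere_parameters[OF g]) (rule that)
  have "radius J g ^ 4 = t powr (-1)"
    unfolding r using t by (simp add: powr_power)
  also have "\<dots> = 1 / t"
    using t by (simp add: powr_neg_one)
  finally have r4: "radius J g ^ 4 = 1 / t" .
  have r0: "0 \<le> radius J g"
    unfolding r by simp
  have cyg: "cygan J z c = sqrt (norm (polH z c))" if "z \<in> Hdom J" for z
    using that c cygan_boundary by (simp add: Hdom_iff)
  have sqrt4: "sqrt (norm (polH z c)) ^ 4 = (norm (polH z c))\<^sup>2" for z
    using power_mult[of "sqrt (norm (polH z c))" 2 2] by simp
  have ext: "z \<in> ext_sphere J g \<longleftrightarrow> 1 < t * (norm (polH z c))\<^sup>2" if z: "z \<in> Hdom J" for z
  proof -
    have "z \<in> ext_sphere J g \<longleftrightarrow> \<not> sqrt (norm (polH z c)) \<le> radius J g"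
      using z by (simp add: ext_sphere_def c cyg not_le)
    also have "\<dots> \<longleftrightarrow> \<not> sqrt (norm (polH z c)) ^ 4 \<le> radius J g ^ 4"
      using power_mono_iff[OF _ r0, of "sqrt (norm (polH z c))" 4] by simp
    also have "\<dots> \<longleftrightarrow> 1 < t * (norm (polH z c))\<^sup>2"
      unfolding r4 sqrt4 using t by (simp add: not_le field_simps)
    finally show ?thesis .
  qed
  have int: "z \<in> int_sphere J g \<longleftrightarrow> t * (norm (polH z c))\<^sup>2 < 1" if z: "z \<in> Hdom J" for z
  proof -
    have "z \<in> int_sphere J g \<longleftrightarrow> \<not> radius J g \<le> sqrt (norm (polH z c))"
      using z by (simp add: int_sphere_def c cyg not_le)
    also have "\<dots> \<longleftrightarrow> \<not> radius J g ^ 4 \<le> sqrt (norm (polH z c)) ^ 4"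
      using power_mono_iff[OF r0, of "sqrt (norm (polH z c))" 4] by simp
    also have "\<dots> \<longleftrightarrow> t * (norm (polH z c))\<^sup>2 < 1"
      unfolding r4 sqrt4 using t by (simp add: not_le field_simps)
    finally show ?thesis .
  qed
  have compare: "htH J (actH g z) < htH J z \<longleftrightarrow> 1 < t * (norm (polH z c))\<^sup>2"
      "htH J z < htH J (actH g z) \<longleftrightarrow> t * (norm (polH z c))\<^sup>2 < 1" if z: "z \<in> Hdom J" for z
  proof -
    have pos: "0 < htH J (actH g z)"
      using actH_mem[OF g(1) z] by (simp add: Hdom_iff)
    define x where "x = t * (norm (polH z c))\<^sup>2"
    have eq: "htH J (actH g z) * x = htH J z"
      unfolding x_def by (rule height[OF z])
    show "htH J (actH g z) < htH J z \<longleftrightarrow> 1 < t * (norm (polH z c))\<^sup>2"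
      unfolding x_def[symmetric] eq[symmetric] using pos mult_less_cancel_left_pos[of _ 1 x] by simp
    show "htH J z < htH J (actH g z) \<longleftrightarrow> t * (norm (polH z c))\<^sup>2 < 1"
      unfolding x_def[symmetric] eq[symmetric] using pos mult_less_cancel_left_pos[of _ x 1] by simp
  qed
  show ?thesis
    by (rule that[OF t c(1) ext int compare])
qed

lemma ext_sphere_iff:
  assumes "g \<in> \<Gamma>" "g \<noteq> id" "z \<in> Hdom J"
  shows "z \<in> ext_sphere J g \<longleftrightarrow> htH J (actH g z) < htH J z"
  by (rule sphere_condition[OF assms(1,2)]) (simp add: assms(3))

lemma int_sphere_iff:
  assumes "g \<in> \<Gamma>" "g \<noteq> id" "z \<in> Hdom J"
  shows "z \<in> int_sphere J g \<longleftrightarrow> htH J z < htH J (actH g z)"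
  by (rule sphere_condition[OF assms(1,2)]) (simp add: assms(3))

lemma open_ext_sphere:
  assumes "g \<in> \<Gamma>" "g \<noteq> id"
  shows "open (ext_sphere J g)"
proof (rule sphere_condition[OF assms])
  fix t c assume "\<And>z. z \<in> Hdom J \<Longrightarrow> z \<in> ext_sphere J g \<longleftrightarrow> 1 < t * (norm (polH z c))\<^sup>2"
  then have "ext_sphere J g = Hdom J \<inter> {z. 1 < t * (norm (polH z c))\<^sup>2}"
    by (auto simp: ext_sphere_def)
  moreover have "open {z. 1 < t * (norm (polH z c))\<^sup>2}"
    by (intro open_Collect_less continuous_intros continuous_on_polH)
  ultimately show ?thesis
    using open_Hdom by auto
qed

lemma lift_mem: "z \<in> Hdom J \<Longrightarrow> 0 \<le> s \<Longrightarrow> lift s z \<in> Hdom J"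
  by (simp add: Hdom_iff htH_lift)

text \<open>Going up strictly increases \<open>|polH z c|\<close> because its real part is positive.\<close>

lemma lift_exterior:
  assumes g: "g \<in> \<Gamma>" "g \<noteq> id" and z: "z \<in> Hdom J" and s: "0 < s"
    and le: "htH J (actH g z) \<le> htH J z"
  shows "htH J (actH g (lift s z)) < htH J (lift s z)"
proof (rule sphere_condition[OF g])
  fix t c assume t: "0 < t" and c: "htH J c = 0"
    and lt: "\<And>z. z \<in> Hdom J \<Longrightarrow> htH J (actH g z) < htH J z \<longleftrightarrow> 1 < t * (norm (polH z c))\<^sup>2"
    and gt: "\<And>z. z \<in> Hdom J \<Longrightarrow> htH J z < htH J (actH g z) \<longleftrightarrow> t * (norm (polH z c))\<^sup>2 < 1"
  have "0 < htH J z"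
    using z by (simp add: Hdom_iff)
  moreover have "0 \<le> 1/2 * (norm (snd z - snd c))\<^sup>2"
    by simp
  ultimately have "0 < reC J (polH z c)"
    unfolding reC_polH c by linarith
  then have "(norm (polH z c))\<^sup>2 < (norm (polH (lift s z) c))\<^sup>2"
    unfolding norm_polH_lift using s by (simp add: pos_add_strict)
  then have "t * (norm (polH z c))\<^sup>2 < t * (norm (polH (lift s z) c))\<^sup>2"
    using t by simp
  moreover have "1 \<le> t * (norm (polH z c))\<^sup>2"
    using gt[OF z] le by linarith
  ultimately show ?thesis
    using lt[OF lift_mem[OF z]] s by simp
qed

text \<open>Since \<open>|polH (lift s z) c| \<ge> s\<close> for all \<open>z\<close> at once, the height from which points are lowered
  does not depend on \<open>z\<close>.\<close>

lemma lift_exterior_eventually: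
  assumes g: "g \<in> \<Gamma>" "g \<noteq> id"
  shows "\<forall>\<^sub>F s in at_top. \<forall>z\<in>Hdom J. htH J (actH g (lift s z)) < htH J (lift s z)"
proof (rule sphere_condition[OF g])
  fix t c assume t: "0 < t" and c: "htH J c = 0"
    and lt: "\<And>z. z \<in> Hdom J \<Longrightarrow> htH J (actH g z) < htH J z \<longleftrightarrow> 1 < t * (norm (polH z c))\<^sup>2"
  have "htH J (actH g (lift s z)) < htH J (lift s z)"
    if s: "1 + 1 / t \<le> s" and z: "z \<in> Hdom J" for s z
  proof -
    have "1 / t < s" "1 < s"
      using s t by (auto intro: less_le_trans[of _ "1 + 1 / t"])
    then have "1 < t * s"
      using t by (simp add: field_simps)
    also have "\<dots> \<le> t * s\<^sup>2"
      using \<open>1 < s\<close> t by (simp add: power2_eq_square)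
    also have "s \<le> norm (polH (lift s z) c)"
    proof -
      have "0 < htH J z"
        using z by (simp add: Hdom_iff)
      moreover have "0 \<le> 1/2 * (norm (snd (lift s z) - snd c))\<^sup>2"
        by simp
      ultimately have "s \<le> reC J (polH (lift s z) c)"
        unfolding reC_polH c htH_lift by linarith
      then show ?thesis
        using abs_reC_le[of "polH (lift s z) c"] by linarith
    qed
    then have "t * s\<^sup>2 \<le> t * (norm (polH (lift s z) c))\<^sup>2"
      using \<open>1 < s\<close> t by (simp add: power_mono)
    finally show ?thesis
      using lt[OF lift_mem[OF z]] \<open>1 < s\<close> by simp
  qed
  then show ?thesis
    unfolding eventually_at_top_linorder by blast
qed

subsection \<open>Boundedness of orbits\<close>

text \<open>A neighbourhood of infinity contains the complement of a compact set, so an orbit that does not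
  accumulate at infinity stays in a compact set.\<close>

lemma base_orbit_bounded:
  obtains z0 B where "z0 \<in> Hdom J" "\<And>g. g \<in> \<Gamma> \<Longrightarrow> norm (actH g z0) \<le> B"
proof -
  obtain z0 where z0: "z0 \<in> Hdom J"
    and lim: "None \<notin> Hbar_top J derived_set_of {actHbar g (Some z0) |g. g \<in> \<Gamma>}"
    using Omega unfolding Omega_def limit_set_def by blast
  have "None \<in> topspace (Hbar_top J)"
    by (simp add: Hbar_top_def Hbar_def)
  then obtain T where T: "openin (Hbar_top J) T" "None \<in> T"
    and away: "\<And>y. y \<in> {actHbar g (Some z0) |g. g \<in> \<Gamma>} \<Longrightarrow> y \<in> T \<Longrightarrow> y = None"
    using lim unfolding in_derived_set_of by blast
  obtain U where U: "openin (Alexandroff_compactification euclidean) U" "T = U \<inter> Hbar J"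
    using T(1) unfolding Hbar_top_def openin_subtopology by blast
  obtain C where C: "compact C" "U = insert None (Some ` (- C))"
    using U T(2) unfolding openin_Alexandroff_compactification by (auto simp: Compl_eq_Diff_UNIV)
  have "actH g z0 \<in> C" if g: "g \<in> \<Gamma>" for g
  proof (rule ccontr)
    assume "actH g z0 \<notin> C"
    moreover have "Some (actH g z0) \<in> Hbar J"
      using actH_mem[OF g z0] by (auto simp: Hbar_def Hdom_def)
    ultimately have "Some (actH g z0) \<in> T"
      using U(2) C(2) by blast
    then show False
      using away actHbar_Some(2)[OF preserves_ratio_mem[OF g] z0] g by force
  qed
  moreover obtain B where "\<And>x. x \<in> C \<Longrightarrow> norm x \<le> B"
    using compact_imp_bounded[OF C(1)] unfolding bounded_iff by blast
  ultimately show ?thesis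
    using that[OF z0] by blast
qed

text \<open>A bound on the ratio together with a bound on one of the two points bounds the other point:
  the real part of the polarized height dominates both the height and half the squared distance of
  the \<open>V\<close>-components.\<close>

lemma bounded_by_ratio:
  assumes z: "0 < htH J z" and w: "0 < htH J w" "norm w \<le> B"
    and D: "0 \<le> D" "(norm (polH z w))\<^sup>2 / (htH J z * htH J w) \<le> D"
  shows "norm z \<le> D * B + B + (B + sqrt (2 * (D * B))) * (B + 1)"
proof -
  let ?N = "norm (polH z w)"
  have hw: "htH J w \<le> B"
  proof -
    have "htH J w \<le> reC J (fst w)"
      by (simp add: htH_eq)
    also have "\<dots> \<le> norm (fst w)"
      using abs_reC_le[of "fst w"] by linarith
    also have "\<dots> \<le> norm w"
      using norm_fst_le[of "fst w" "snd w"] by simp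
    finally show ?thesis using w(2) by simp
  qed
  have N2: "?N\<^sup>2 \<le> D * (htH J z * htH J w)"
    using D(2) z w(1) by (simp add: pos_divide_le_eq)
  have N: "htH J z + 1/2 * (norm (snd z - snd w))\<^sup>2 \<le> ?N"
    using abs_reC_le[of "polH z w"] w(1) unfolding reC_polH by linarith
  have hN: "htH J z \<le> ?N"
    using N zero_le_power2[of "norm (snd z - snd w)"] by linarith
  have N0: "0 < ?N"
    using hN z by linarith
  have "?N * ?N \<le> ?N * (D * B)"
  proof -
    have "D * (htH J z * htH J w) \<le> D * (?N * B)"
      using D(1) hN hw z w(1) N0 by (intro mult_left_mono mult_mono) auto
    then show ?thesis
      using N2 by (simp add: power2_eq_square mult_ac)
  qed
  then have NDB: "?N \<le> D * B"
    using N0 by simp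
  have "(norm (snd z - snd w))\<^sup>2 \<le> 2 * (D * B)"
    using N NDB z by simp
  then have "norm (snd z - snd w) \<le> sqrt (2 * (D * B))"
    by (rule real_le_rsqrt)
  moreover have "norm (snd w) \<le> B" "norm (fst w) \<le> B"
    using w(2) norm_snd_le[where x = "fst w" and y = "snd w"] norm_fst_le[of "fst w" "snd w"] by simp_all
  ultimately have v: "norm (snd z) \<le> B + sqrt (2 * (D * B))"
    using norm_triangle_sub[of "snd z" "snd w"] by linarith
  have "fst z = polH z w - cnj (fst w) + herm (snd z) (snd w)"
    by (simp add: polH_def)
  then have "norm (fst z) \<le> ?N + norm (cnj (fst w)) + norm (herm (snd z) (snd w))"
    by (metis norm_triangle_le norm_triangle_ineq4 add_right_mono)
  also have "\<dots> \<le> D * B + B + (B + sqrt (2 * (D * B))) * B"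
  proof -
    have "norm (snd z) * norm (snd w) \<le> (B + sqrt (2 * (D * B))) * B"
      by (intro mult_mono v \<open>norm (snd w) \<le> B\<close> norm_ge_zero order_trans[OF norm_ge_zero v])
    then show ?thesis
      using NDB \<open>norm (fst w) \<le> B\<close> norm_herm_le[of "snd z" "snd w"] by simp
  qed
  finally have "norm (fst z) + norm (snd z) \<le> D * B + B + (B + sqrt (2 * (D * B))) * (B + 1)"
    using v by (simp add: distrib_left)
  then show ?thesis
    using norm_Pair_le[of "fst z" "snd z"] by simp
qed

text \<open>The invariant quotient of \<open>gz\<close> and \<open>gz\<^sub>0\<close> is that of \<open>z\<close> and \<open>z\<^sub>0\<close>, which is bounded on \<open>K\<close>.\<close>

lemma compact_orbit_bounded:
  assumes K: "compact K" "K \<subseteq> Hdom J"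
  obtains B where "\<And>g z. g \<in> \<Gamma> \<Longrightarrow> z \<in> K \<Longrightarrow> norm (actH g z) \<le> B"
proof -
  obtain z0 B where z0: "z0 \<in> Hdom J" and B: "\<And>g. g \<in> \<Gamma> \<Longrightarrow> norm (actH g z0) \<le> B"
    by (rule base_orbit_bounded) (rule that)
  define \<delta> where "\<delta> z = (norm (polH z z0))\<^sup>2 / (htH J z * htH J z0)" for z
  have "continuous_on K \<delta>"
    unfolding \<delta>_def using K(2) z0
    by (intro continuous_intros continuous_on_polH) (auto simp: Hdom_iff)
  then have "bounded (\<delta> ` K)"
    using K(1) compact_continuous_image compact_imp_bounded by blast
  then obtain D where "\<And>z. z \<in> K \<Longrightarrow> \<bar>\<delta> z\<bar> \<le> D"
    unfolding bounded_iff by auto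
  then have D: "\<delta> z \<le> max 0 D" if "z \<in> K" for z
    using that by fastforce
  show ?thesis
  proof (rule that)
    fix g z assume g: "g \<in> \<Gamma>" and z: "z \<in> K"
    then have zH: "z \<in> Hdom J" using K(2) by blast
    show "norm (actH g z) \<le> max 0 D * B + B + (B + sqrt (2 * (max 0 D * B))) * (B + 1)"
    proof (rule bounded_by_ratio)
      show "0 < htH J (actH g z)" "0 < htH J (actH g z0)"
        using actH_mem[OF g zH] actH_mem[OF g z0] by (simp_all add: Hdom_iff)
      show "norm (actH g z0) \<le> B" by (rule B[OF g])
      show "(norm (polH (actH g z) (actH g z0)))\<^sup>2 / (htH J (actH g z) * htH J (actH g z0)) \<le> max 0 D"
        unfolding actH_ratio[OF preserves_ratio_mem[OF g] zH z0] using D[OF z] by (simp add: \<delta>_def)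
    qed simp
  qed
qed

subsection \<open>Local finiteness\<close>

text \<open>The images of \<open>K\<close> at height at least \<open>\<epsilon>\<close> stay in one compact subset of \<open>H\<close>. Adjoining \<open>K\<close> to it
  gives a compact set \<open>L\<close> that meets \<open>gL\<close> for each \<open>g\<close> in question.\<close>

lemma finite_high:
  assumes K: "compact K" "K \<subseteq> Hdom J" and \<epsilon>: "0 < \<epsilon>"
  shows "finite {g \<in> \<Gamma>. \<exists>z\<in>K. \<epsilon> \<le> htH J (actH g z)}"
proof -
  obtain B where B: "\<And>g z. g \<in> \<Gamma> \<Longrightarrow> z \<in> K \<Longrightarrow> norm (actH g z) \<le> B"
    by (rule compact_orbit_bounded[OF K]) (rule that)
  define L where "L = K \<union> (cball 0 B \<inter> {w. \<epsilon> \<le> htH J w})"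
  have "closed {w. \<epsilon> \<le> htH J w}"
    by (intro closed_Collect_le continuous_intros)
  then have "compact L"
    unfolding L_def using K(1) by (intro compact_Un compact_Int_closed compact_cball)
  moreover have "L \<subseteq> Hdom J"
    unfolding L_def using K(2) \<epsilon> by (auto simp: Hdom_iff)
  ultimately have "finite {g \<in> \<Gamma>. L \<inter> actH g ` L \<noteq> {}}"
    using discont unfolding properly_discontinuous_def by blast
  moreover have "L \<inter> actH g ` L \<noteq> {}" if "g \<in> \<Gamma>" "z \<in> K" "\<epsilon> \<le> htH J (actH g z)" for g z
  proof -
    have "z \<in> L" "actH g z \<in> L"
      using that B unfolding L_def by auto
    then show ?thesis by blast
  qed
  ultimately show ?thesis
    by (elim finite_subset[rotated]) blast
qed

lemma finite_nonexterior:
  assumes K: "compact K" "K \<subseteq> Hdom J"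
  shows "finite {g \<in> \<Gamma>. \<exists>z\<in>K. htH J z \<le> htH J (actH g z)}"
proof (cases "K = {}")
  case False
  obtain z0 where z0: "z0 \<in> K" "\<And>z. z \<in> K \<Longrightarrow> htH J z0 \<le> htH J z"
    using continuous_attains_inf[OF K(1) False, of "htH J"] continuous_on_htH[OF continuous_on_id]
    by auto
  then have "finite {g \<in> \<Gamma>. \<exists>z\<in>K. htH J z0 \<le> htH J (actH g z)}"
    using K(2) by (intro finite_high K) (auto simp: Hdom_iff)
  then show ?thesis
    by (rule finite_subset[rotated]) (use z0(2) order_trans in blast)
qed simp

lemma highest_in_orbit:
  assumes z: "z \<in> Hdom J"
  obtains g where "g \<in> \<Gamma>" "\<And>h. h \<in> \<Gamma> \<Longrightarrow> htH J (actH h z) \<le> htH J (actH g z)"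
proof -
  define S where "S = {g \<in> \<Gamma>. htH J z \<le> htH J (actH g z)}"
  have "finite S"
    using finite_nonexterior[of "{z}"] z unfolding S_def by simp
  moreover have "id \<in> S"
    unfolding S_def using id_mem actH_id[OF z] by simp
  ultimately obtain g where g: "g \<in> S" "\<And>h. h \<in> S \<Longrightarrow> htH J (actH h z) \<le> htH J (actH g z)"
    using ex_is_arg_min_if_finite[of S "\<lambda>g. - htH J (actH g z)"] unfolding is_arg_min_linorder
    by auto
  show ?thesis
  proof
    show "g \<in> \<Gamma>" using g(1) unfolding S_def by simp
    fix h assume "h \<in> \<Gamma>"
    then show "htH J (actH h z) \<le> htH J (actH g z)"
      using g unfolding S_def by (cases "h \<in> S") (auto simp: S_def)
  qed
qed

subsection \<open>The common exterior\<close>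

abbreviation F :: "('c \<times> 'v) set" where "F \<equiv> common_exterior J \<Gamma>"

lemma F_iff:
  "z \<in> F \<longleftrightarrow> z \<in> Hdom J \<and> (\<forall>g\<in>\<Gamma>. g \<noteq> id \<longrightarrow> htH J (actH g z) < htH J z)"
  unfolding common_exterior_def stab using ext_sphere_iff by blast

lemma F_subset: "F \<subseteq> Hdom J"
  using F_iff by blast

text \<open>On a compact ball around a point, all but finitely many of the conditions are automatic.\<close>

lemma open_F: "open F"
proof (rule open_subopen[THEN iffD2], rule ballI)
  fix z assume z: "z \<in> F"
  then obtain r where r: "0 < r" "cball z r \<subseteq> Hdom J"
    using open_Hdom F_subset unfolding open_contains_cball by blast
  define S where "S = {g \<in> \<Gamma>. \<exists>w\<in>cball z r. htH J w \<le> htH J (actH g w)} - {id}"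
  have S: "finite S" "S \<subseteq> \<Gamma> - {id}"
    unfolding S_def using finite_nonexterior[OF compact_cball r(2)] by auto
  define U where "U = ball z r \<inter> (\<Inter>g\<in>S. ext_sphere J g)"
  have "open U"
    unfolding U_def using S by (auto intro!: open_Int open_INT open_ext_sphere)
  moreover have "z \<in> U"
    using z r(1) S unfolding U_def common_exterior_def stab by auto
  moreover have "U \<subseteq> F"
  proof
    fix w assume w: "w \<in> U"
    then have wH: "w \<in> Hdom J" "w \<in> cball z r"
      using r(2) unfolding U_def by auto
    have "htH J (actH g w) < htH J w" if g: "g \<in> \<Gamma>" "g \<noteq> id" for g
    proof (cases "g \<in> S")
      case True
      then show ?thesis
        using w ext_sphere_iff[OF g wH(1)] unfolding U_def by blast
    next
      case False
      then show ?thesis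
        using g wH(2) unfolding S_def by (auto simp: not_le)
    qed
    then show "w \<in> F"
      using wH(1) F_iff by blast
  qed
  ultimately show "\<exists>T. open T \<and> z \<in> T \<and> T \<subseteq> F"
    by blast
qed

lemma lift_mem_F:
  assumes z: "z \<in> Hdom J" and le: "\<And>g. g \<in> \<Gamma> \<Longrightarrow> htH J (actH g z) \<le> htH J z" and s: "0 < s"
  shows "lift s z \<in> F"
  unfolding F_iff using lift_mem[OF z, of s] lift_exterior[OF _ _ z s le] s by simp

lemma F_le:
  assumes "z \<in> F" "g \<in> \<Gamma>"
  shows "htH J (actH g z) \<le> htH J z"
  using assms actH_id[of z] unfolding F_iff by (cases "g = id") (simp_all add: less_imp_le)

lemma lift_F:
  assumes "z \<in> F" "0 \<le> s"
  shows "lift s z \<in> F"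
proof (cases "s = 0")
  case False
  then show ?thesis
    using lift_mem_F[OF subsetD[OF F_subset assms(1)] F_le[OF assms(1)]] assms(2) by simp
qed (simp add: assms lift_0)

lemma closure_F:
  assumes "z \<in> Hdom J" "\<And>g. g \<in> \<Gamma> \<Longrightarrow> htH J (actH g z) \<le> htH J z"
  shows "z \<in> closure F"
  unfolding closure_approachable
proof (intro allI impI)
  fix \<epsilon> :: real assume "0 < \<epsilon>"
  then have "lift (\<epsilon> / 2) z \<in> F" "dist (lift (\<epsilon> / 2) z) z < \<epsilon>"
    using lift_mem_F[OF assms, of "\<epsilon> / 2"] by (simp_all add: dist_lift)
  then show "\<exists>y\<in>F. dist y z < \<epsilon>" by blast
qed

text \<open>Two points of the common exterior are joined by going straight up, across along a translate
  of the segment between them, and down again. A compact segment meets only finitely many isometric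
  balls, so a high enough translate avoids all of them.\<close>

lemma connected_F: "connected F"
  unfolding connected_iff_connected_component
proof (intro ballI)
  fix z w assume z: "z \<in> F" and w: "w \<in> F"
  define K where "K = closed_segment z w"
  have K: "compact K" "K \<subseteq> Hdom J"
    unfolding K_def using z w F_subset convex_Hdom by (auto intro: closed_segment_subset[THEN subsetD])
  define S where "S = {g \<in> \<Gamma>. \<exists>x\<in>K. htH J x \<le> htH J (actH g x)} - {id}"
  have S: "finite S" "S \<subseteq> \<Gamma> - {id}"
    unfolding S_def using finite_nonexterior[OF K] by auto
  have "\<forall>\<^sub>F s in at_top. \<forall>g\<in>S. \<forall>x\<in>Hdom J. htH J (actH g (lift s x)) < htH J (lift s x)"
    using S lift_exterior_eventually by (intro eventually_ball_finite) auto
  then have "\<forall>\<^sub>F s in at_top. 0 < s \<and>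
      (\<forall>g\<in>S. \<forall>x\<in>Hdom J. htH J (actH g (lift s x)) < htH J (lift s x))"
    using eventually_gt_at_top by (rule eventually_conj[rotated])
  then obtain s :: real where s: "0 < s"
    and Sout: "\<And>g x. g \<in> S \<Longrightarrow> x \<in> Hdom J \<Longrightarrow> htH J (actH g (lift s x)) < htH J (lift s x)"
    using eventually_happens'[OF trivial_limit_at_top_linorder] by blast
  have across: "lift s ` K \<subseteq> F"
  proof (rule image_subsetI)
    fix x assume x: "x \<in> K"
    then have xH: "x \<in> Hdom J" using K(2) by blast
    have "htH J (actH g (lift s x)) < htH J (lift s x)" if g: "g \<in> \<Gamma>" "g \<noteq> id" for g
    proof (cases "g \<in> S")
      case False
      then have "htH J (actH g x) \<le> htH J x"
        using g x unfolding S_def by (auto simp: not_le less_imp_le)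
      then show ?thesis
        by (rule lift_exterior[OF g xH s])
    qed (use Sout xH in blast)
    then show "lift s x \<in> F"
      using lift_mem[OF xH] s F_iff by simp
  qed
  have up: "connected_component F x (lift s x)" if x: "x \<in> F" for x
    unfolding connected_component_def
  proof (intro exI conjI)
    have "continuous_on {0..s} (\<lambda>r. lift r x)"
      unfolding lift_def by (intro continuous_intros)
    then show "connected ((\<lambda>r. lift r x) ` {0..s})"
      by (rule connected_continuous_image) simp
    show "(\<lambda>r. lift r x) ` {0..s} \<subseteq> F"
      using lift_F[OF x] by auto
    show "x \<in> (\<lambda>r. lift r x) ` {0..s}"
      by (rule image_eqI[of _ _ 0]) (use s in \<open>auto simp: lift_0\<close>)
    show "lift s x \<in> (\<lambda>r. lift r x) ` {0..s}"
      using s by simp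
  qed
  have "connected_component F (lift s z) (lift s w)"
    unfolding connected_component_def
  proof (intro exI conjI)
    have "continuous_on K (lift s)"
      unfolding lift_def by (intro continuous_intros)
    then show "connected (lift s ` K)"
      by (rule connected_continuous_image) (simp add: K_def)
  qed (use across in \<open>auto simp: K_def\<close>)
  then show "connected_component F z w"
    using up[OF z] up[OF w] connected_component_sym connected_component_trans by metis
qed

text \<open>If \<open>z\<close> and \<open>kz\<close> both lie in \<open>F\<close>, then \<open>k\<close> lowers \<open>z\<close> and its inverse lowers \<open>kz\<close>.\<close>

lemma disjoint_translates:
  assumes "g \<in> \<Gamma>" "h \<in> \<Gamma>" "g \<noteq> h"
  shows "actH g ` F \<inter> actH h ` F = {}"
proof (rule ccontr)
  assume "actH g ` F \<inter> actH h ` F \<noteq> {}"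
  then obtain z w where z: "z \<in> F" and w: "w \<in> F" and eq: "actH g z = actH h w"
    by blast
  note zH = subsetD[OF F_subset z] and wH = subsetD[OF F_subset w]
  define k where "k = inv_into UNIV h \<circ> g"
  have k: "k \<in> \<Gamma>"
    unfolding k_def using assms comp_mem inv_mem by blast
  have nid: "k \<noteq> id"
  proof
    assume "k = id"
    then have "h \<circ> (inv_into UNIV h \<circ> g) = h"
      by (simp add: k_def)
    moreover have "h \<circ> inv_into UNIV h = id"
      using bij_is_surj[OF bij_mem[OF assms(2)]] by (simp add: surj_iff)
    ultimately show False
      using assms(3) by (simp flip: comp_assoc)
  qed
  have "actH k z = actH (inv_into UNIV h) (actH h w)"
    using actH_comp[OF inv_mem[OF assms(2)] assms(1) zH] by (simp add: k_def eq)
  then have kz: "actH k z = w"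
    using actH_inv[OF assms(2) wH] by simp
  have "htH J w < htH J z"
    using z k nid kz unfolding F_iff by blast
  moreover have "htH J z < htH J w"
  proof -
    have "inv_into UNIV k \<noteq> id"
      using nid inv_comp[OF k] by auto
    then have "htH J (actH (inv_into UNIV k) w) < htH J w"
      using w inv_mem[OF k] unfolding F_iff by blast
    then show ?thesis
      using actH_inv[OF k zH] by (simp add: kz)
  qed
  ultimately show False by simp
qed

lemma closure_of_Hdom: "T \<subseteq> Hdom J \<Longrightarrow> top_of_set (Hdom J) closure_of T = Hdom J \<inter> closure T"
  by (simp add: closure_of_subtopology Int_absorb1)

text \<open>Every point is moved into the closure of \<open>F\<close> by an element taking it to a highest position.\<close>

lemma translates_cover: "Hdom J = (\<Union>g\<in>\<Gamma>. actH g ` (top_of_set (Hdom J) closure_of F))"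
proof (intro equalityI subsetI)
  fix z assume z: "z \<in> Hdom J"
  obtain g where g: "g \<in> \<Gamma>" "\<And>h. h \<in> \<Gamma> \<Longrightarrow> htH J (actH h z) \<le> htH J (actH g z)"
    by (rule highest_in_orbit[OF z]) (rule that)
  have gz: "actH g z \<in> Hdom J"
    by (rule actH_mem[OF g(1) z])
  have "htH J (actH h (actH g z)) \<le> htH J (actH g z)" if "h \<in> \<Gamma>" for h
    using g(2)[OF comp_mem[OF that g(1)]] actH_comp[OF that g(1) z] by simp
  then have "actH g z \<in> closure F"
    by (rule closure_F[OF gz])
  moreover have "z = actH (inv_into UNIV g) (actH g z)"
    using actH_inv[OF g(1) z] by simp
  ultimately show "z \<in> (\<Union>g\<in>\<Gamma>. actH g ` (top_of_set (Hdom J) closure_of F))"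
    using inv_mem[OF g(1)] gz unfolding closure_of_Hdom[OF F_subset] by blast
next
  fix z assume "z \<in> (\<Union>g\<in>\<Gamma>. actH g ` (top_of_set (Hdom J) closure_of F))"
  then show "z \<in> Hdom J"
    using actH_mem unfolding closure_of_Hdom[OF F_subset] by blast
qed

lemma fundamental_domain_F: "fundamental_domain J \<Gamma> F"
  unfolding fundamental_domain_def
  using F_subset open_F connected_F disjoint_translates translates_cover by blast

text \<open>A point outside \<open>F\<close> is not lowered by some \<open>g\<close>. Then \<open>g\<close> raises all points straight below it,
  since a point below that is not raised would be lowered after going up.\<close>

lemma type_O_group: "type_O J \<Gamma>"
proof -
  define I where "I = (\<Union>g\<in>\<Gamma> - stab_inf \<Gamma>. int_sphere J g)"
  have IH: "I \<subseteq> Hdom J"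
    by (auto simp: I_def int_sphere_def)
  have "F \<inter> I = {}"
    using F_iff int_sphere_iff by (fastforce simp: I_def stab)
  then have disj: "F \<inter> closure I = {}"
    using open_F open_Int_closure_eq_empty by blast
  have "z \<in> closure I" if z: "z \<in> Hdom J" "z \<notin> F" for z
    unfolding closure_approachable
  proof (intro allI impI)
    fix \<epsilon> :: real assume \<epsilon>: "0 < \<epsilon>"
    obtain g where g: "g \<in> \<Gamma>" "g \<noteq> id" and ge: "htH J z \<le> htH J (actH g z)"
      using z F_iff not_le by blast
    define s where "s = min (\<epsilon> / 2) (htH J z / 2)"
    have s: "0 < s" "s < \<epsilon>" "s < htH J z"
      using \<epsilon> z(1) unfolding s_def Hdom_iff by auto
    define y where "y = lift (- s) z"
    have yH: "y \<in> Hdom J"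
      using s by (simp add: y_def Hdom_iff htH_lift)
    have z_eq: "z = lift s y"
      by (simp add: y_def lift_lift lift_0)
    have "htH J y < htH J (actH g y)"
      using lift_exterior[OF g yH s(1)] ge unfolding z_eq[symmetric] by (meson not_le)
    then have "y \<in> I"
      using g int_sphere_iff[OF g yH] by (auto simp: I_def stab)
    moreover have "dist y z < \<epsilon>"
      using s by (simp add: y_def dist_lift)
    ultimately show "\<exists>y\<in>I. dist y z < \<epsilon>" by blast
  qed
  then show ?thesis
    unfolding type_O_def I_def[symmetric] closure_of_Hdom[OF IH]
    using disj F_subset by blast
qed

lemma type_F_group: "type_F J (\<Gamma> - stab_inf \<Gamma>)"
proof -
  have "g \<in> \<Gamma>" if "g \<in> generate (Ggrp J) (\<Gamma> - {id})" for g
    using that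
  proof induction
    case one
    then show ?case using subgroup.one_closed[OF subgrp] .
  next
    case (incl h)
    then show ?case by simp
  next
    case (inv h)
    then show ?case using subgroup.m_inv_closed[OF subgrp] by simp
  next
    case (eng h1 h2)
    then show ?case using subgroup.m_closed[OF subgrp] by simp
  qed
  moreover have "g \<in> generate (Ggrp J) (\<Gamma> - {id})" if "g \<in> \<Gamma>" for g
  proof (cases "g = id")
    case True
    then show ?thesis
      using generate.one[of "Ggrp J" "\<Gamma> - {id}"] by (simp add: Ggrp_def)
  qed (use that in \<open>auto intro: generate.incl\<close>)
  ultimately have gen: "generate (Ggrp J) (\<Gamma> - {id}) = \<Gamma>"
    by blast
  have "\<exists>g\<in>\<Gamma>. \<forall>h\<in>\<Gamma>. htH J (actH h z) \<le> htH J (actH g z)" if "z \<in> Hdom J" for z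
    by (rule highest_in_orbit[OF that]) blast
  then show ?thesis
    unfolding type_F_def stab gen using in_carrier by blast
qed

end

theorem proposition4p38:
  fixes J :: "'c::euclidean_space \<Rightarrow> 'v::euclidean_space \<Rightarrow> 'v"
    and \<Gamma> :: "(('c \<times> 'v) option \<Rightarrow> ('c \<times> 'v) option) set"
  assumes "J2C_module J" and "J2C_associative J"
    and "subgroup \<Gamma> (Ggrp J)" and "properly_discontinuous J \<Gamma>"
    and "\<Gamma> \<subseteq> Gres J"
    and "stab_inf \<Gamma> = {id}"
    and "None \<in> Omega J \<Gamma>"
  shows "type_O J \<Gamma> \<and>
    type_F J (\<Gamma> - stab_inf \<Gamma>) \<and>
    fundamental_domain J \<Gamma> (common_exterior J \<Gamma>)"
proof -
  interpret discontinuous_group J \<Gamma>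
    by (rule discontinuous_group.intro[OF associative_J2C.intro[OF assms(1,2)]
          discontinuous_group_axioms.intro[OF assms(3-7)]])
  show ?thesis
    using type_O_group type_F_group fundamental_domain_F by blast
qed

end
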